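(* Let $\mathcal{G}$ be a colored $n$-cycle with $n\in\{3,5,7\}$. Then a linear binomial lies in $I_{\mathcal{G}}$ if and only if there is a corresponding graph symmetry of $\mathcal{G}$.
   Context: A colored $n$-cycle $\mathcal{G}$ is the cycle graph on vertices $1,\dots,n$ with edges $\{i,i+1\}$ (indices mod $n$), together with a coloring $\lambda$ of vertices and edges, vertex colors disjoint from edge colors. Introduce an indeterminate $t_c$ for each color $c$ and let $K$ be the symmetric $n\times n$ matrix with $K_{ii}=t_{\lambda(i)}$, $K_{i,i+1}=K_{i+1,i}=t_{\lambda(\{i,i+1\})}$, all other entries $0$. The vanishing ideal $I_{\mathcal{G}}$ is the kernel of the ring homomorphism $\mathbb{R}[\sigma_{ij}:1\le i\le j\le n]\to\mathbb{R}(t_c)$, $\sigma_{ij}\mapsto (K^{-1})_{ij}$ (with $\sigma_{ji}=\sigma_{ij}$). A graph symmetry is a permutation matrix $P$ with $PKP^{-1}=K$; equivalently a permutation $\pi$ of vertices mapping edges to edges and preserving all vertex and edge colors. A linear binomial is $\sigma_{ij}-\sigma_{xy}$ with $\{i,j\}\neq\{x,y\}$; a corresponding graph symmetry is a graph symmetry $\pi$ with $\{\pi(i),\pi(j)\}=\{x,y\}$. *)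

theory Defs
  imports
    "HOL-Library.Poly_Mapping"
    "HOL-Computational_Algebra.Polynomial_Factorial"
    "HOL-Combinatorics.Permutations"
    "Jordan_Normal_Form.Matrix"
begin

section \<open>Real polynomials and rational functions in several indeterminates\<close>

type_synonym 'v mpoly = "('v \<Rightarrow>\<^sub>0 nat) \<Rightarrow>\<^sub>0 real"

(* The linear order on 'c is used only for the library's instance of the class idom. *)
type_synonym 'c ratfun = "'c mpoly fract"

definition mconst :: "real \<Rightarrow> 'v mpoly" where
  "mconst a = Poly_Mapping.single 0 a"

definition mvar :: "'v \<Rightarrow> 'v mpoly" where
  "mvar v = Poly_Mapping.single (Poly_Mapping.single v 1) 1"

definition mvars :: "'v mpoly \<Rightarrow> 'v set" where
  "mvars p = (\<Union>m \<in> Poly_Mapping.keys p. Poly_Mapping.keys m)"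

text \<open>The homomorphism of real algebras, from polynomials to rational functions, that sends
  the variable \<open>v\<close> to \<open>f v\<close>.\<close>

definition eval_mpoly :: "('v \<Rightarrow> 'c::linorder ratfun) \<Rightarrow> 'v mpoly \<Rightarrow> 'c ratfun" where
  "eval_mpoly f p = (\<Sum>m \<in> Poly_Mapping.keys p.
     to_fract (mconst (Poly_Mapping.lookup p m)) *
     (\<Prod>v \<in> Poly_Mapping.keys m. f v ^ Poly_Mapping.lookup m v))"

definition indet :: "'c::linorder \<Rightarrow> 'c ratfun" where
  "indet c = to_fract (mvar c)"


section \<open>Colored cycles\<close>

text \<open>The vertices of the \<open>n\<close>-cycle are \<open>0, \<dots>, n - 1\<close>, in line with the 0-based indices of
  matrices.  A coloring is a pair of functions, \<open>cv\<close> on vertices and \<open>ce\<close> on edges; their values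
  outside the cycle play no role.\<close>

definition cycle_edges :: "nat \<Rightarrow> nat set set" where
  "cycle_edges n = (\<lambda>i. {i, Suc i mod n}) ` {..<n}"

definition colored_cycle :: "nat \<Rightarrow> (nat \<Rightarrow> 'c) \<Rightarrow> (nat set \<Rightarrow> 'c) \<Rightarrow> bool" where
  "colored_cycle n cv ce \<longleftrightarrow> 3 \<le> n \<and> cv ` {..<n} \<inter> ce ` cycle_edges n = {}"

definition conc_mat ::
  "nat \<Rightarrow> (nat \<Rightarrow> 'c::linorder) \<Rightarrow> (nat set \<Rightarrow> 'c) \<Rightarrow> 'c ratfun mat" where
  "conc_mat n cv ce = mat n n (\<lambda>(i, j).
     if i = j then indet (cv i)
     else if {i, j} \<in> cycle_edges n then indet (ce {i, j})
     else 0)"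

text \<open>Inverse of an invertible matrix.  The matrix \<open>conc_mat n cv ce\<close> of a colored cycle is
  invertible: as vertex colors and edge colors are disjoint, its determinant specializes to
  \<open>1\<close> when the indeterminates of vertex colors are set to \<open>1\<close> and those of edge colors to \<open>0\<close>.\<close>

definition inv_mat :: "'a::field mat \<Rightarrow> 'a mat" where
  "inv_mat A = (THE B. inverts_mat A B \<and> inverts_mat B A)"


section \<open>Vanishing ideal\<close>

text \<open>The variables are indexed by pairs \<open>(i, j)\<close> with \<open>i \<le> j < n\<close>; \<open>sigma i j\<close> and
  \<open>sigma j i\<close> are the same variable.\<close>

definition sigma :: "nat \<Rightarrow> nat \<Rightarrow> (nat \<times> nat) mpoly" where
  "sigma i j = mvar (min i j, max i j)"

definition vanishing_ideal ::
  "nat \<Rightarrow> (nat \<Rightarrow> 'c::linorder) \<Rightarrow> (nat set \<Rightarrow> 'c) \<Rightarrow> (nat \<times> nat) mpoly set" where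
  "vanishing_ideal n cv ce =
     {p. mvars p \<subseteq> {(i, j). i \<le> j \<and> j < n} \<and>
         eval_mpoly (\<lambda>ij. inv_mat (conc_mat n cv ce) $$ ij) p = 0}"


section \<open>Graph symmetries\<close>

text \<open>The permutation matrix of \<open>\<pi>\<close> maps the \<open>j\<close>-th unit vector to the \<open>\<pi> j\<close>-th one.\<close>

definition perm_mat :: "nat \<Rightarrow> (nat \<Rightarrow> nat) \<Rightarrow> 'a::zero_neq_one mat" where
  "perm_mat n \<pi> = mat n n (\<lambda>(i, j). if i = \<pi> j then 1 else 0)"

definition graph_symmetry ::
  "nat \<Rightarrow> (nat \<Rightarrow> 'c::linorder) \<Rightarrow> (nat set \<Rightarrow> 'c) \<Rightarrow> (nat \<Rightarrow> nat) \<Rightarrow> bool" where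
  "graph_symmetry n cv ce \<pi> \<longleftrightarrow> \<pi> permutes {..<n} \<and>
     perm_mat n \<pi> * conc_mat n cv ce * inv_mat (perm_mat n \<pi>) = conc_mat n cv ce"

end

(*
  As n is odd, every unordered pair of vertices is {c - h, c + h} mod n for a unique center c and a
  unique h with 2 h < n.  The (i, j) cofactor of the cycle matrix is a signed sum over the two paths
  from i to j: the product of the edges of one path times the determinant of the interior of the
  other.  The two path lengths have different parity, so scaling the edge indeterminates by z
  separates the two terms (z -> -z), and each term by the number of edges in a matching.  The lowest
  terms show that equal cofactors have equal h.

  If the centers agree as well, so do the pairs; otherwise move the origin so that the centers are m
  and -m.  Replace the colors by powers of distinct primes, and put w_k = e_k^2 / (v_k v_(k+1)) for
  the edge k between the vertices k and k + 1.  The equality of the cofactors then says that, on both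
  paths, products of edges, products of interior vertices, and all sums over r-matchings of products
  of w^j (for every j) agree.  Power sums determine multisets, and w_k = w_l forces equal edge colors;
  in each of the 20 cases for (n, h, m) this yields invariance under the reflection k -> -k.
*)
theory Submission
  imports Defs "Jordan_Normal_Form.Determinant"
begin

section \<open>Continuants and the adjugate of a periodic tridiagonal matrix\<close>

text \<open>The value at \<open>l\<close> is the determinant of the path with the \<open>l - 1\<close> vertices \<open>s, \<dots>, s + l - 2\<close>,
  where the edge \<open>k\<close> joins \<open>k\<close> and \<open>k + 1\<close>.  The shift by one, with value \<open>0\<close> at \<open>l = 0\<close>, spares
  case distinctions at the ends of the cycle.\<close>

fun continuant :: "(int \<Rightarrow> 'a::comm_ring_1) \<Rightarrow> (int \<Rightarrow> 'a) \<Rightarrow> int \<Rightarrow> nat \<Rightarrow> 'a" where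
  "continuant v e s 0 = 0"
| "continuant v e s (Suc 0) = 1"
| "continuant v e s (Suc (Suc l)) = v s * continuant v e (s + 1) (Suc l) - (e s)\<^sup>2 * continuant v e (s + 2) l"

text \<open>The defining recursion expands along the first vertex, this one along the last: both
  continuants in the recursion are expanded at their last vertex and regrouped. It serves the path
  in \<open>cyc_adj\<close> whose right end moves with \<open>l\<close>.\<close>

lemma continuant_right:
  "continuant v e s (Suc (Suc l)) = v (s + int l) * continuant v e s (Suc l) - (e (s + int l - 1))\<^sup>2 * continuant v e s l"
proof (induction v e s l rule: continuant.induct)
  case (3 v e s l)
  have "continuant v e s (Suc (Suc (Suc (Suc l)))) =
     v s * continuant v e (s + 1) (Suc (Suc (Suc l))) - (e s)\<^sup>2 * continuant v e (s + 2) (Suc (Suc l))"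
    by simp
  also have "continuant v e (s + 1) (Suc (Suc (Suc l))) = v (s + int (Suc (Suc l))) * continuant v e (s + 1) (Suc (Suc l))
      - (e (s + int (Suc (Suc l)) - 1))\<^sup>2 * continuant v e (s + 1) (Suc l)"
    using 3(1) by (simp add: algebra_simps)
  also have "continuant v e (s + 2) (Suc (Suc l)) = v (s + int (Suc (Suc l))) * continuant v e (s + 2) (Suc l)
      - (e (s + int (Suc (Suc l)) - 1))\<^sup>2 * continuant v e (s + 2) l"
    using 3(2) by (simp add: algebra_simps)
  finally show ?case by (simp add: algebra_simps)
qed (simp_all add: algebra_simps)

text \<open>The cofactor of the cycle matrix for the vertices \<open>s\<close> and \<open>s + l\<close>; the two summands belong to the
  two paths between them.\<close>

definition cyc_adj :: "nat \<Rightarrow> (int \<Rightarrow> 'a::comm_ring_1) \<Rightarrow> (int \<Rightarrow> 'a) \<Rightarrow> int \<Rightarrow> nat \<Rightarrow> 'a" where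
  "cyc_adj n v e s l =
     (-1) ^ l * (\<Prod>k<l. e (s + int k)) * continuant v e (s + int l + 1) (n - l)
     + (-1) ^ (n - l) * (\<Prod>k=l..<n. e (s + int k)) * continuant v e (s + 1) l"

text \<open>Laplace expansion along the row of the vertex \<open>s\<close>, whose neighbours lie
  \<open>1\<close> and \<open>n - 1\<close> steps ahead; the signs are part of
  \<open>cyc_adj\<close>.\<close>

definition cyc_det :: "nat \<Rightarrow> (int \<Rightarrow> 'a::comm_ring_1) \<Rightarrow> (int \<Rightarrow> 'a) \<Rightarrow> int \<Rightarrow> 'a" where
  "cyc_det n v e s =
     v s * cyc_adj n v e s 0 + e s * cyc_adj n v e s 1 + e (s - 1) * cyc_adj n v e s (n - 1)"

lemma continuant_shift: "continuant (\<lambda>k. v (c + k)) (\<lambda>k. e (c + k)) s l = continuant v e (c + s) l"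
  by (induction "\<lambda>k. v (c + k)" "\<lambda>k. e (c + k)" s l rule: continuant.induct) (simp_all add: add.assoc)

lemma cyc_adj_shift: "cyc_adj n (\<lambda>k. v (c + k)) (\<lambda>k. e (c + k)) s l = cyc_adj n v e (c + s) l"
  using continuant_shift[of v c e] by (simp add: cyc_adj_def add.assoc)

lemma cyc_det_shift: "cyc_det n (\<lambda>k. v (c + k)) (\<lambda>k. e (c + k)) s = cyc_det n v e (c + s)"
  by (simp add: cyc_det_def cyc_adj_shift add_diff_eq)

lemma cyc_adj_wrap: "cyc_adj n v e s n = cyc_adj n v e s 0"
  by (simp add: cyc_adj_def)

text \<open>An off-diagonal entry of adjugate times matrix. The terms of the two paths cancel
  separately: for the first path by the defining recursion of \<open>continuant\<close>, for the
  second by \<open>continuant_right\<close>.\<close>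

lemma cyc_adj_row:
  assumes "0 < l" "l < n"
  shows "v (s + int l) * cyc_adj n v e s l + e (s + int l - 1) * cyc_adj n v e s (l - 1)
     + e (s + int l) * cyc_adj n v e s (l + 1) = 0"
proof -
  obtain j where l: "l = Suc j" using assms by (cases l) auto
  obtain d where n: "n = l + Suc d" using assms less_iff_Suc_add by auto
  have A: "continuant v e (s + int l) (Suc (Suc d)) =
      v (s + int l) * continuant v e (s + int l + 1) (Suc d)
      - (e (s + int l))\<^sup>2 * continuant v e (s + int l + 2) d"
    by simp
  have B: "continuant v e (s + 1) (Suc (Suc j)) = v (s + int l) * continuant v e (s + 1) (Suc j) - (e (s + int l - 1))\<^sup>2 * continuant v e (s + 1) j"
    unfolding continuant_right by (simp add: l add.assoc)
  have Q: "(\<Prod>k=j..<n. e (s + int k)) = e (s + int j) * e (s + int l) * (\<Prod>k=l+1..<n. e (s + int k))"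
    "(\<Prod>k=l..<n. e (s + int k)) = e (s + int l) * (\<Prod>k=l+1..<n. e (s + int k))"
    using n l prod.atLeast_Suc_lessThan[of j n "\<lambda>k. e (s + int k)"]
      prod.atLeast_Suc_lessThan[of l n "\<lambda>k. e (s + int k)"]
    by (simp_all del: prod.op_ivl_Suc)
  have P: "(\<Prod>k<l. e (s + int k)) = (\<Prod>k<j. e (s + int k)) * e (s + int j)"
    "(\<Prod>k<l+1. e (s + int k)) = (\<Prod>k<j. e (s + int k)) * e (s + int j) * e (s + int l)"
    by (simp_all add: l)
  have d: "n - l = Suc d" "n - (l - 1) = Suc (Suc d)" "n - (l + 1) = d" "l - 1 = j" "l + 1 = Suc (Suc j)"
    using n l by auto
  have sh: "s + int l - 1 = s + int j" "s + int j + 1 = s + int l" "s + int (l + 1) + 1 = s + int l + 2" using l by auto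
  show ?thesis
    unfolding cyc_adj_def P Q d(1-3)
    unfolding d(4) Q P sh A
    unfolding d(5) B unfolding sh l
    by (simp add: algebra_simps power2_eq_square)
qed

section \<open>Weighted matchings of paths\<close>

text \<open>Sum over the matchings with \<open>r\<close> edges of the path with \<open>l - 1\<close> vertices starting at \<open>s\<close>.\<close>

fun matching_sum :: "(int \<Rightarrow> real) \<Rightarrow> nat \<Rightarrow> int \<Rightarrow> nat \<Rightarrow> real" where
  "matching_sum w r s 0 = 0"
| "matching_sum w r s (Suc 0) = (if r = 0 then 1 else 0)"
| "matching_sum w r s (Suc (Suc l)) = matching_sum w r (s + 1) (Suc l) + (if r = 0 then 0 else w s * matching_sum w (r - 1) (s + 2) l)"

definition edge_weight :: "(int \<Rightarrow> real) \<Rightarrow> (int \<Rightarrow> real) \<Rightarrow> int \<Rightarrow> real" where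
  "edge_weight v e k = (e k)\<^sup>2 / (v k * v (k + 1))"

text \<open>A path with \<open>l - 1\<close> vertices has room for \<open>r\<close> disjoint edges
  only if \<open>2 * r < l\<close>.\<close>

lemma matching_sum_vanish: "l \<le> 2 * r \<Longrightarrow> matching_sum w r s l = 0"
  by (induction w r s l rule: matching_sum.induct) auto

text \<open>Only fixed points and swaps of neighbours, that is, matchings, contribute to a
  tridiagonal determinant. Each matching edge replaces its two vertex factors by minus a squared
  edge; once the vertex product is pulled out, this is \<open>- z^2\<close> times an edge
  weight.\<close>

lemma continuant_matching_sum:
  assumes "\<And>k. v k \<noteq> 0"
  shows "continuant v (\<lambda>k. z * e k) s l =
    (\<Prod>k<l - 1. v (s + int k)) * (\<Sum>r<Suc l. (- z\<^sup>2) ^ r * matching_sum (edge_weight v e) r s l)"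
  using assms
proof (induction v e s l rule: continuant.induct)
  case (2 v e s)
  show ?case by (simp add: lessThan_Suc)
next
  case (3 v e s l)
  let ?w = "edge_weight v e"
  let ?S = "\<lambda>s l. (\<Sum>r<Suc l. (- z\<^sup>2) ^ r * matching_sum ?w r s l)"
  \<comment> \<open>The bound of the sum may be raised freely, because larger matchings vanish; this
    aligns the sums for different lengths.\<close>
  have ext: "?S s l = (\<Sum>r<N. (- z\<^sup>2) ^ r * matching_sum ?w r s l)" if "l < N" for s l N
    using that by (intro sum.mono_neutral_left) (auto simp: matching_sum_vanish)
  have "?S s (Suc (Suc l)) = (\<Sum>r<Suc (Suc (Suc l)). (- z\<^sup>2) ^ r * matching_sum ?w r (s+1) (Suc l))
     + (\<Sum>r<Suc (Suc (Suc l)). (if r = 0 then 0 else (- z\<^sup>2) ^ r * (?w s * matching_sum ?w (r - 1) (s + 2) l)))"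
    unfolding sum.distrib[symmetric]
    by (intro sum.cong) (auto simp: algebra_simps)
  also have "(\<Sum>r<Suc (Suc (Suc l)). (if r = 0 then 0 else (- z\<^sup>2) ^ r * (?w s * matching_sum ?w (r - 1) (s + 2) l)))
    = (\<Sum>r<Suc (Suc l). (- z\<^sup>2) ^ Suc r * (?w s * matching_sum ?w r (s + 2) l))"
    by (subst sum.lessThan_Suc_shift) simp
  also have "\<dots> = - z\<^sup>2 * ?w s * (\<Sum>r<Suc (Suc l). (- z\<^sup>2) ^ r * matching_sum ?w r (s + 2) l)"
    by (simp add: sum_distrib_left algebra_simps)
  also have "(\<Sum>r<Suc (Suc (Suc l)). (- z\<^sup>2) ^ r * matching_sum ?w r (s+1) (Suc l)) = ?S (s + 1) (Suc l)"
    by (rule ext[symmetric]) simp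
  also have "(\<Sum>r<Suc (Suc l). (- z\<^sup>2) ^ r * matching_sum ?w r (s + 2) l) = ?S (s + 2) l"
    by (rule ext[symmetric]) simp
  finally have S: "?S s (Suc (Suc l)) = ?S (s+1) (Suc l) - z\<^sup>2 * ?w s * ?S (s+2) l"
    by simp
  have P1: "(\<Prod>k<Suc l. v (s + int k)) = v s * (\<Prod>k<l. v (s + 1 + int k))"
    by (subst prod.lessThan_Suc_shift) (simp add: algebra_simps)
  have "continuant v (\<lambda>k. z * e k) s (Suc (Suc l)) = v s * ((\<Prod>k<l. v (s + 1 + int k)) * ?S (s+1) (Suc l))
      - (z * e s)\<^sup>2 * ((\<Prod>k<l-1. v (s + 2 + int k)) * ?S (s+2) l)"
    using 3 by simp
  also have "\<dots> = (\<Prod>k<Suc l. v (s + int k)) * ?S s (Suc (Suc l))"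
  \<comment> \<open>For \<open>l = 0\<close> the factor \<open>v (s + 1)\<close> is absent from the
    product, but the term with \<open>continuant\<close> at \<open>0\<close> vanishes as
    well.\<close>
  proof (cases l)
    case 0
    then show ?thesis unfolding S P1 by simp
  next
    case (Suc j)
    have P2: "(\<Prod>k<l. v (s + 1 + int k)) = v (s + 1) * (\<Prod>k<j. v (s + 2 + int k))"
      unfolding Suc by (subst prod.lessThan_Suc_shift) (simp add: algebra_simps)
    have "(z * e s)\<^sup>2 = v s * v (s + 1) * (z\<^sup>2 * ?w s)"
      using 3(3)[of s] 3(3)[of "s+1"] by (simp add: edge_weight_def power_mult_distrib)
    then have "v s * (v (s + 1) * Q * X) - (z * e s)\<^sup>2 * (Q * Y) = v s * (v (s + 1) * Q) * (X - z\<^sup>2 * ?w s * Y)"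
      for Q X Y
      by (simp only:) (simp add: algebra_simps)
    then show ?thesis unfolding S P1 P2 by (simp only: Suc diff_Suc_1)
  qed
  finally show ?case by simp
qed simp

section \<open>Separation of the two paths and of the matching sizes\<close>

text \<open>Four values of \<open>z\<close> with distinct squares give an invertible Vandermonde
  system for the four coefficients. Degree 3 in \<open>- z^2\<close> suffices because a path with at
  most seven vertices has no matching with more than three edges.\<close>

lemma even_cubic_coeffs:
  fixes a b :: "nat \<Rightarrow> real"
  assumes "\<And>z::real. z \<noteq> 0 \<Longrightarrow> (\<Sum>r<4. (- z\<^sup>2) ^ r * a r) = (\<Sum>r<4. (- z\<^sup>2) ^ r * b r)" "r < 4"
  shows "a r = b r"
proof -
  have "a 0 = b 0 \<and> a 1 = b 1 \<and> a 2 = b 2 \<and> a 3 = b 3"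
    using assms(1)[of 1] assms(1)[of 2] assms(1)[of 3] assms(1)[of 4]
    by (simp add: eval_nat_numeral)
  moreover have "r = 0 \<or> r = 1 \<or> r = 2 \<or> r = 3" using assms(2) by auto
  ultimately show ?thesis by auto
qed

lemma continuant_matching_sum_4:
  assumes "\<And>k. v k \<noteq> 0" "l \<le> 8"
  shows "continuant v (\<lambda>k. z * e k) s l =
    (\<Prod>k<l - 1. v (s + int k)) * (\<Sum>r<4. (- z\<^sup>2) ^ r * matching_sum (edge_weight v e) r s l)"
proof -
  have "(\<Sum>r<Suc l. (- z\<^sup>2) ^ r * matching_sum (edge_weight v e) r s l) = (\<Sum>r<Suc l + 4. (- z\<^sup>2) ^ r * matching_sum (edge_weight v e) r s l)"
    by (intro sum.mono_neutral_left) (auto simp: matching_sum_vanish)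
  also have "\<dots> = (\<Sum>r<4. (- z\<^sup>2) ^ r * matching_sum (edge_weight v e) r s l)"
    using assms(2) by (intro sum.mono_neutral_right) (auto simp: matching_sum_vanish)
  finally show ?thesis by (simp only: continuant_matching_sum[OF assms(1)])
qed

text \<open>The two conclusions belong to the two terms of \<open>cyc_adj\<close>; the powers of
  \<open>z\<close> inside each term separate the numbers of matching edges, one equation for every
  \<open>r\<close>.\<close>

lemma level_products:
  fixes v e :: "int \<Rightarrow> real"
  assumes n: "odd n" "2 * h < n" "n \<le> 7"
    and v: "\<And>k. v k \<noteq> 0"
    and H: "\<And>z. cyc_adj n v (\<lambda>k. z * e k) s (2 * h) = cyc_adj n v (\<lambda>k. z * e k) s' (2 * h)"
    and r: "r < 4"
  shows "(\<Prod>k<2 * h. e (s + int k)) * (\<Prod>k<n - 2 * h - 1. v (s + int (2 * h) + 1 + int k))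
       * matching_sum (edge_weight v e) r (s + int (2 * h) + 1) (n - 2 * h)
     = (\<Prod>k<2 * h. e (s' + int k)) * (\<Prod>k<n - 2 * h - 1. v (s' + int (2 * h) + 1 + int k))
       * matching_sum (edge_weight v e) r (s' + int (2 * h) + 1) (n - 2 * h)" (is "?A s = ?A s'")
   and "(\<Prod>k=2 * h..<n. e (s + int k)) * (\<Prod>k<2 * h - 1. v (s + 1 + int k))
       * matching_sum (edge_weight v e) r (s + 1) (2 * h)
     = (\<Prod>k=2 * h..<n. e (s' + int k)) * (\<Prod>k<2 * h - 1. v (s' + 1 + int k))
       * matching_sum (edge_weight v e) r (s' + 1) (2 * h)" (is "?B s = ?B s'")
proof -
  define a where "a t r = (\<Prod>k<2 * h. e (t + int k)) * (\<Prod>k<n - 2 * h - 1. v (t + int (2 * h) + 1 + int k))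
       * matching_sum (edge_weight v e) r (t + int (2 * h) + 1) (n - 2 * h)" for t r
  define b where "b t r = (\<Prod>k=2 * h..<n. e (t + int k)) * (\<Prod>k<2 * h - 1. v (t + 1 + int k))
       * matching_sum (edge_weight v e) r (t + 1) (2 * h)" for t r
  define f where "f t z = (\<Sum>r<4. (- z\<^sup>2) ^ r * a t r)" for t and z :: real
  define g where "g t z = (\<Sum>r<4. (- z\<^sup>2) ^ r * b t r)" for t and z :: real
  have le: "n - 2 * h \<le> 8" "2 * h \<le> 8" using n by auto
  have on: "odd (n - 2 * h)" using n by simp
  have X: "cyc_adj n v (\<lambda>k. z * e k) t (2 * h) = z ^ (2 * h) * f t z - z ^ (n - 2 * h) * g t z" for t z
  proof -
    have pe: "(\<Prod>k=2 * h..<n. z * e (t + int k)) = z ^ (n - 2 * h) * (\<Prod>k=2 * h..<n. e (t + int k))"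
      by (simp add: prod.distrib)
    have f: "f t z = (\<Prod>k<2 * h. e (t + int k)) * continuant v (\<lambda>k. z * e k) (t + int (2 * h) + 1) (n - 2 * h)"
      unfolding continuant_matching_sum_4[OF v le(1)] f_def a_def by (simp add: sum_distrib_left mult_ac)
    have g: "g t z = (\<Prod>k=2 * h..<n. e (t + int k)) * continuant v (\<lambda>k. z * e k) (t + 1) (2 * h)"
      unfolding continuant_matching_sum_4[OF v le(2)] g_def b_def by (simp add: sum_distrib_left mult_ac)
    show ?thesis unfolding cyc_adj_def f g pe using on by (simp add: prod.distrib)
  qed
  \<comment> \<open>As \<open>n\<close> is odd, replacing \<open>z\<close> by \<open>- z\<close> changes the sign of exactly one of the two terms.\<close>
  have "f s z = f s' z \<and> g s z = g s' z" if "z \<noteq> 0" for z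
  proof -
    have m: "f t (- z) = f t z" "g t (- z) = g t z" for t by (simp_all add: f_def g_def)
    have "z ^ (2 * h) * f s z - z ^ (n - 2 * h) * g s z = z ^ (2 * h) * f s' z - z ^ (n - 2 * h) * g s' z"
      using H[of z] by (simp add: X)
    moreover have "z ^ (2 * h) * f s z + z ^ (n - 2 * h) * g s z = z ^ (2 * h) * f s' z + z ^ (n - 2 * h) * g s' z"
      using H[of "- z"] unfolding X m using on by simp
    ultimately have "z ^ (2 * h) * f s z = z ^ (2 * h) * f s' z" "z ^ (n - 2 * h) * g s z = z ^ (n - 2 * h) * g s' z"
      by linarith+
    then show ?thesis using that by simp
  qed
  then have "a s r = a s' r" "b s r = b s' r"
    using r unfolding f_def g_def by (auto intro: even_cubic_coeffs)
  then show "?A s = ?A s'" "?B s = ?B s'" by (simp_all only: a_def b_def)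
qed

lemma edge_weight_power: "edge_weight (\<lambda>k. v k ^ j) (\<lambda>k. e k ^ j) = (\<lambda>k. edge_weight v e k ^ j)"
  by (simp add: edge_weight_def fun_eq_iff power_divide power_mult_distrib mult.commute flip: power_mult)

lemma matching_sum_0: "0 < l \<Longrightarrow> matching_sum w 0 s l = 1"
  by (induction w "0 :: nat" s l rule: matching_sum.induct) auto

text \<open>Suitable exponents isolate the factors in \<open>level_products\<close>. At
  \<open>r = 0\<close> the matching sum is 1, so the exponents 0 and 1 leave only the edges or only
  the vertices; with a common exponent \<open>j\<close> these nonzero products cancel and the
  matching sum of the \<open>j\<close>-th powers remains. For \<open>h = 0\<close> the second term
  of \<open>cyc_adj\<close> is zero and yields no edge equation, hence the condition
  \<open>0 < h\<close>.\<close>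

lemma level_equations:
  fixes v e :: "int \<Rightarrow> real"
  assumes n: "odd n" "2 * h < n" "n \<le> 7"
    and v: "\<And>k. v k \<noteq> 0" and e: "\<And>k. e k \<noteq> 0"
    and H: "\<And>a b z. cyc_adj n (\<lambda>k. v k ^ a) (\<lambda>k. z * e k ^ b) s (2 * h) =
       cyc_adj n (\<lambda>k. v k ^ a) (\<lambda>k. z * e k ^ b) s' (2 * h)"
  shows "(\<Prod>k<2 * h. e (s + int k)) = (\<Prod>k<2 * h. e (s' + int k))" (is "?E s = ?E s'")
    and "(\<Prod>k<n - 2 * h - 1. v (s + int (2 * h) + 1 + int k)) =
      (\<Prod>k<n - 2 * h - 1. v (s' + int (2 * h) + 1 + int k))" (is "?V s = ?V s'")
    and "r < 4 \<Longrightarrow> matching_sum (\<lambda>k. edge_weight v e k ^ j) r (s + int (2 * h) + 1) (n - 2 * h)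
      = matching_sum (\<lambda>k. edge_weight v e k ^ j) r (s' + int (2 * h) + 1) (n - 2 * h)"
    and "0 < h \<Longrightarrow> (\<Prod>k=2 * h..<n. e (s + int k)) = (\<Prod>k=2 * h..<n. e (s' + int k))"
      (is "_ \<Longrightarrow> ?E' s = ?E' s'")
    and "(\<Prod>k<2 * h - 1. v (s + 1 + int k)) = (\<Prod>k<2 * h - 1. v (s' + 1 + int k))" (is "?V' s = ?V' s'")
    and "r < 4 \<Longrightarrow> matching_sum (\<lambda>k. edge_weight v e k ^ j) r (s + 1) (2 * h) = matching_sum (\<lambda>k. edge_weight v e k ^ j) r (s' + 1) (2 * h)"
proof -
  have va: "v k ^ a \<noteq> 0" for k a using v by simp
  have pos: "0 < n - 2 * h" using n by simp
  show E: "?E s = ?E s'"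
    using level_products(1)[where v = "\<lambda>k. v k ^ 0" and e = "\<lambda>k. e k ^ 1" and r = 0, OF n va H]
    by (simp add: matching_sum_0[OF pos])
  show V: "?V s = ?V s'"
    using level_products(1)[where v = "\<lambda>k. v k ^ 1" and e = "\<lambda>k. e k ^ 0" and r = 0, OF n va H]
    by (simp add: matching_sum_0[OF pos])
  have nz: "?E t \<noteq> 0" "?V t \<noteq> 0" "?E' t \<noteq> 0" "?V' t \<noteq> 0" for t using v e by simp_all
  show "matching_sum (\<lambda>k. edge_weight v e k ^ j) r (s + int (2 * h) + 1) (n - 2 * h)
      = matching_sum (\<lambda>k. edge_weight v e k ^ j) r (s' + int (2 * h) + 1) (n - 2 * h)" if "r < 4"
    using level_products(1)[where v = "\<lambda>k. v k ^ j" and e = "\<lambda>k. e k ^ j" and r = r, OF n va H that] E V nz[of s']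
    by (simp add: edge_weight_power flip: prod_power_distrib)
  show E': "?E' s = ?E' s'" if "0 < h"
    using level_products(2)[where v = "\<lambda>k. v k ^ 0" and e = "\<lambda>k. e k ^ 1" and r = 0, OF n va H] that
    by (simp add: matching_sum_0)
  show V': "?V' s = ?V' s'"
  proof (cases "h = 0")
    case False
    then show ?thesis
      using level_products(2)[where v = "\<lambda>k. v k ^ 1" and e = "\<lambda>k. e k ^ 0" and r = 0, OF n va H]
      by (simp add: matching_sum_0)
  qed simp
  show "matching_sum (\<lambda>k. edge_weight v e k ^ j) r (s + 1) (2 * h) = matching_sum (\<lambda>k. edge_weight v e k ^ j) r (s' + 1) (2 * h)" if "r < 4"
  proof (cases "h = 0")
    case False
    then show ?thesis
      using level_products(2)[where v = "\<lambda>k. v k ^ j" and e = "\<lambda>k. e k ^ j" and r = r, OF n va H that] E' V' nz[of s']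
      by (simp add: edge_weight_power flip: prod_power_distrib)
  qed simp
qed

text \<open>Equal sums and equal sums of squares give equal products, so \<open>a\<close> is a root
  of \<open>(x - c) * (x - d)\<close>.\<close>

lemma two_powers:
  fixes a b c d :: real
  assumes "\<And>j. a ^ j + b ^ j = c ^ j + d ^ j"
  shows "a = c \<and> b = d \<or> a = d \<and> b = c"
proof -
  have 1: "a + b = c + d" using assms[of 1] by simp
  have 2: "a\<^sup>2 + b\<^sup>2 = c\<^sup>2 + d\<^sup>2" using assms[of 2] .
  have d: "d = a + b - c" using 1 by simp
  have "(a - c) * (a - d) = 0"
    unfolding d using 2[unfolded d] by (simp add: power2_eq_square algebra_simps)
  then show ?thesis using 1 by auto
qed

text \<open>Newton's identity expresses the product of three numbers by their first three power
  sums.\<close>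

lemma three_powers_prod:
  fixes a b c x y z :: real
  assumes "\<And>j. a ^ j + b ^ j + c ^ j = x ^ j + y ^ j + z ^ j"
  shows "a * b * c = x * y * z"
proof -
  have 1: "a + b + c = x + y + z" using assms[of 1] by simp
  have 2: "a\<^sup>2 + b\<^sup>2 + c\<^sup>2 = x\<^sup>2 + y\<^sup>2 + z\<^sup>2" using assms[of 2] .
  have 3: "a ^ 3 + b ^ 3 + c ^ 3 = x ^ 3 + y ^ 3 + z ^ 3" using assms[of 3] .
  have N: "6 * (p * q * r) = (p + q + r) ^ 3 - 3 * (p + q + r) * (p\<^sup>2 + q\<^sup>2 + r\<^sup>2) + 2 * (p ^ 3 + q ^ 3 + r ^ 3)"
    for p q r :: real
    by (simp add: power2_eq_square power3_eq_cube algebra_simps)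
  show ?thesis using N[of a b c] N[of x y z] 1 2 3 by simp
qed

section \<open>Mirror symmetry of weighted cycles of length 3, 5 and 7\<close>

text \<open>The representatives are chosen symmetric about 0, so that the reflection of the vertices
  becomes negation.\<close>

lemma wrap_7:
  fixes f :: "int \<Rightarrow> real"
  assumes "\<And>k. f (k + 7) = f k"
  shows "f 4 = f (-3)" "f 5 = f (-2)" "f 6 = f (-1)" "f 7 = f 0" "f 8 = f 1" "f 9 = f 2"
    "f (-4) = f 3" "f (-5) = f 2" "f (-6) = f 1"
  using assms[of "-3"] assms[of "-2"] assms[of "-1"] assms[of 0] assms[of 1] assms[of 2]
    assms[of "-4"] assms[of "-5"] assms[of "-6"] by simp_all

lemma wrap_5:
  fixes f :: "int \<Rightarrow> real"
  assumes "\<And>k. f (k + 5) = f k"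
  shows "f 3 = f (-2)" "f 4 = f (-1)" "f 5 = f 0" "f 6 = f 1" "f (-3) = f 2" "f (-4) = f 1"
  using assms[of "-2"] assms[of "-1"] assms[of 0] assms[of 1] assms[of "-3"] assms[of "-4"] by simp_all

lemma wrap_3:
  fixes f :: "int \<Rightarrow> real"
  assumes "\<And>k. f (k + 3) = f k"
  shows "f 2 = f (-1)" "f 3 = f 0" "f (-2) = f 1"
  using assms[of "-1"] assms[of 0] assms[of "-2"] by simp_all

text \<open>The last assumption holds if the weights are primes and no edge shares its prime with a vertex.\<close>

locale cycle_weights =
  fixes n :: nat and v e :: "int \<Rightarrow> real"
  assumes v_pos: "v k > 0" and e_pos: "e k > 0"
    and v_period: "v (k + int n) = v k" and e_period: "e (k + int n) = e k"
    and e_eqI: "(e k)\<^sup>2 * (v l * v (l + 1)) = (e l)\<^sup>2 * (v k * v (k + 1)) \<Longrightarrow> e k = e l"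
begin

definition w :: "int \<Rightarrow> real" where "w = edge_weight v e"

lemma nonzero [simp]: "v k \<noteq> 0" "e k \<noteq> 0" "w k \<noteq> 0"
  using v_pos[of k] e_pos[of k] v_pos[of "k + 1"] by (simp_all add: w_def edge_weight_def)

lemma w_period: "w (k + int n) = w k"
  using v_period[of k] e_period[of k] v_period[of "k + 1"] by (simp add: w_def edge_weight_def ac_simps)

text \<open>Cross-multiplied, equal weights give equal edges by \<open>e_eqI\<close>; cancelling the
  edges leaves the products of the end vertices.\<close>

lemma w_eqD:
  assumes "w k = w l"
  shows "e k = e l \<and> v k * v (k + 1) = v l * v (l + 1)"
proof -
  have *: "(e k)\<^sup>2 * (v l * v (l + 1)) = (e l)\<^sup>2 * (v k * v (k + 1))"
    using assms by (simp add: w_def edge_weight_def frac_eq_eq)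
  then have "e k = e l" by (rule e_eqI)
  with * show ?thesis by simp
qed

text \<open>The pair centered at \<open>m\<close> is \<open>m - h\<close> and \<open>m + h\<close>.
  The independent exponents \<open>a\<close>, \<open>b\<close> and the edge scale \<open>z\<close>
  are exactly the specializations that \<open>level_equations\<close> consumes.\<close>

definition balanced :: "nat \<Rightarrow> int \<Rightarrow> bool" where
  "balanced h m \<longleftrightarrow> (\<forall>a b z.
     cyc_adj n (\<lambda>k. v k ^ a) (\<lambda>k. z * e k ^ b) (m - int h) (2 * h) =
     cyc_adj n (\<lambda>k. v k ^ a) (\<lambda>k. z * e k ^ b) (- m - int h) (2 * h))"

lemma balancedD:
  assumes "odd n" "2 * h < n" "n \<le> 7" and "balanced h m"
  shows "(\<Prod>k<2 * h. e (m - int h + int k)) = (\<Prod>k<2 * h. e (- m - int h + int k))"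
    and "(\<Prod>k<n - 2 * h - 1. v (m - int h + int (2 * h) + 1 + int k)) =
      (\<Prod>k<n - 2 * h - 1. v (- m - int h + int (2 * h) + 1 + int k))"
    and "r < 4 \<Longrightarrow> matching_sum (\<lambda>k. w k ^ j) r (m - int h + int (2 * h) + 1) (n - 2 * h) =
      matching_sum (\<lambda>k. w k ^ j) r (- m - int h + int (2 * h) + 1) (n - 2 * h)"
    and "0 < h \<Longrightarrow>
      (\<Prod>k=2 * h..<n. e (m - int h + int k)) = (\<Prod>k=2 * h..<n. e (- m - int h + int k))"
    and "(\<Prod>k<2 * h - 1. v (m - int h + 1 + int k)) = (\<Prod>k<2 * h - 1. v (- m - int h + 1 + int k))"
    and "r < 4 \<Longrightarrow> matching_sum (\<lambda>k. w k ^ j) r (m - int h + 1) (2 * h) =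
      matching_sum (\<lambda>k. w k ^ j) r (- m - int h + 1) (2 * h)"
  by (rule level_equations[where n = n and h = h and v = v and e = e and s = "m - int h" and s' = "- m - int h",
      OF assms(1-3) nonzero(1,2) assms(4)[unfolded balanced_def, rule_format], folded w_def] | assumption)+

lemmas path_simps = lessThan_Suc numeral_eq_Suc

lemma w_eqI: "e k = e l \<Longrightarrow> v k * v (k + 1) = v l * v (l + 1) \<Longrightarrow> w k = w l"
  by (simp add: w_def edge_weight_def)

text \<open>In \<open>balancedD\<close>, (1) to (3) come from the edges of the path of length \<open>2 * h\<close> around the center and the
  interior of the other path, (4) to (6) from the opposite choice.  The reflection \<open>k \<mapsto> - k\<close> of the
  vertices sends the edge \<open>k\<close> to the edge \<open>- 1 - k\<close>.\<close>

lemma mirror_7: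
  assumes n: "n = 7" and h: "h \<in> {0, 1, 2, 3}" and m: "m \<in> {1, 2, 3}" and B: "balanced h m"
  shows "v (-1) = v 1 \<and> v (-2) = v 2 \<and> v (-3) = v 3 \<and> e (-1) = e 0 \<and> e (-2) = e 1 \<and> e (-3) = e 2"
    (is ?M)
proof -
  note period = v_period[unfolded n, simplified] e_period[unfolded n, simplified] w_period[unfolded n, simplified]
  note wrap = wrap_7[where f = v, OF period(1)] wrap_7[where f = e, OF period(2)] wrap_7[where f = w, OF period(3)]
  have "odd n" "2 * h < n" "n \<le> 7" using n h by auto
  note D = balancedD[OF this B, unfolded n]
  note W = w_eqD[of "-1" 0, simplified] w_eqD[of "-2" 1, simplified] w_eqD[of "-3" 2, simplified]
  have all: ?M if "w (-1) = w 0" "w (-2) = w 1" "w (-3) = w 2"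
    using W that by auto
  consider "h = 0" "m = 1" | "h = 0" "m = 2" | "h = 0" "m = 3"
    | "h = 1" "m = 1" | "h = 1" "m = 2" | "h = 1" "m = 3"
    | "h = 2" "m = 1" | "h = 2" "m = 2" | "h = 2" "m = 3"
    | "h = 3" "m = 1" | "h = 3" "m = 2" | "h = 3" "m = 3"
    using h m by blast
  then show ?thesis
  proof cases
    case 1
    \<comment> \<open>Both paths have six vertices; their perfect matchings (\<open>r = 3\<close>)
      share \<open>w 2\<close> and \<open>w (-3)\<close>, so the remaining edges agree.\<close>
    have w0: "w (-1) = w 0" using D(3)[of 3 1] 1 by (simp add: path_simps wrap algebra_simps)
    have w1: "w (-2) = w 1" using D(3)[of 1 1] 1 w0 by (simp add: path_simps wrap algebra_simps)
    have "w (-3) = w 2" using D(3)[of 2 1] 1 w0 w1 by (simp add: path_simps wrap algebra_simps)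
    with w0 w1 show ?thesis by (rule all)
  next
    case 2
    have "w 1 ^ j + w 2 ^ j = w (-2) ^ j + w (-3) ^ j" for j
      using D(3)[of 1 j] 2 by (simp add: path_simps wrap algebra_simps)
    from two_powers[OF this] show ?thesis
    proof
      assume w12: "w 1 = w (-2) \<and> w 2 = w (-3)"
      have "w (-1) = w 0" using D(3)[of 3 1] 2 w12 by (simp add: path_simps wrap algebra_simps)
      with w12 show ?thesis by (simp add: all)
    next
      assume w12: "w 1 = w (-3) \<and> w 2 = w (-2)"
      have e3: "w 2 * w 0 = w 1 * w (-1)" using D(3)[of 3 1] 2 w12 by (simp add: path_simps wrap algebra_simps)
      \<comment> \<open>Each path has six pairs of disjoint edges. In this crossed case four of the
        products occur on both sides, and the two left over form equal multisets.\<close>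
      have "(w 1 * w 0) ^ j + (w 3 * w 2) ^ j = (w 1 * w 3) ^ j + (w (-1) * w 2) ^ j" for j
        using D(3)[of 2 j] 2 w12 by (simp add: path_simps wrap algebra_simps power_mult_distrib)
      from two_powers[OF this] have "w (-1) = w 0 \<and> w 1 = w 2" using e3 by auto
      with w12 show ?thesis by (simp add: all)
    qed
  next
    case 3
    have w2: "w (-3) = w 2" using D(3)[of 1 1] 3 by (simp add: path_simps wrap algebra_simps)
    have w1: "w (-2) = w 1" using D(3)[of 2 1] 3 w2 by (simp add: path_simps wrap algebra_simps)
    have "w (-1) = w 0" using D(3)[of 3 1] 3 w1 w2 by (simp add: path_simps wrap algebra_simps)
    then show ?thesis using w1 w2 by (rule all)
  next
    case 4
    have v1: "v (-1) = v 1" using D(5) 4 by (simp add: path_simps wrap)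
    have w1: "w (-2) = w 1" using D(3)[of 2 1] 4 by (simp add: path_simps wrap)
    have w2: "w (-3) = w 2" using D(3)[of 1 1] 4 w1 by (simp add: path_simps wrap algebra_simps)
    have e01: "e 0 * e 1 = e (-1) * e (-2)" using D(1) 4 by (simp add: path_simps wrap mult_ac)
    show ?thesis using v1 w1 w2 W e01 by auto
  next
    case 5
    have v2: "v (-2) = v 2" using D(5) 5 by (simp add: path_simps wrap)
    have v13: "v (-3) * v (-1) = v 1 * v 3" using D(2) 5 v2 by (simp add: path_simps wrap mult_ac)
    have e12: "e 1 * e 2 = e (-2) * e (-3)" using D(1) 5 by (simp add: path_simps wrap mult_ac)
    have w02: "w (-3) * w (-1) = w 0 * w 2" using D(3)[of 2 1] 5 by (simp add: path_simps wrap mult_ac)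
    have L1: "w (-3) ^ j + w (-1) ^ j + w (-2) ^ j = w 0 ^ j + w 2 ^ j + w 1 ^ j" for j
      using D(3)[of 1 j] 5 by (simp add: path_simps wrap add_ac)
    \<comment> \<open>Cancelling the outer weights, whose products agree by \<open>w02\<close>, from
      the product of all three leaves the middle ones.\<close>
    have w1: "w (-2) = w 1" using three_powers_prod[OF L1] w02 by simp
    have "w (-3) ^ j + w (-1) ^ j = w 0 ^ j + w 2 ^ j" for j using L1[of j] w1 by simp
    \<comment> \<open>Whichever way the outer weights match, \<open>w1\<close> and
      \<open>e12\<close> force \<open>e (-3) = e 2\<close>, and then
      \<open>e (-1) = e 0\<close>.\<close>
    from two_powers[OF this] have "e (-3) = e 0 \<and> e (-1) = e 2 \<or> e (-3) = e 2 \<and> e (-1) = e 0"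
      using w_eqD by blast
    then show ?thesis using v2 v13 e12 w1 W by auto
  next
    case 6
    have v3: "v (-3) = v 3" using D(5) 6 by (simp add: path_simps wrap)
    have v2: "v (-2) = v 2" using D(2) 6 v3 by (simp add: path_simps wrap)
    have e2: "e (-3) = e 2" using D(1) 6 by (simp add: path_simps wrap)
    have w1: "w (-2) = w 1" using D(3)[of 1 1] 6 by (simp add: path_simps wrap algebra_simps)
    have w0: "w (-1) = w 0" using D(3)[of 2 1] 6 w1 by (simp add: path_simps wrap mult_ac)
    show ?thesis using v3 v2 e2 w0 w1 W by auto
  next
    case 7
    have w2: "w (-3) = w 2" using D(3)[of 1 1] 7 by (simp add: path_simps wrap)
    then have e2: "e (-3) = e 2" using W by blast
    have e1: "e (-2) = e 1" using D(4) 7 e2 by (simp add: path_simps wrap mult_ac)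
    have v23: "v (-3) * v (-2) = v 2 * v 3" using D(2) 7 by (simp add: path_simps wrap mult_ac)
    have v12: "v 1 * v 2 = v (-1) * v (-2)" using D(5) 7 by (simp add: path_simps wrap mult_ac)
    have "w (-1) ^ j + w (-2) ^ j = w 0 ^ j + w 1 ^ j" for j
      using D(6)[of 1 j] 7 by (simp add: path_simps wrap add_ac)
    from two_powers[OF this] show ?thesis
    proof
      assume "w (-1) = w 0 \<and> w (-2) = w 1"
      then show ?thesis using w2 by (simp add: all)
    next
      \<comment> \<open>The crossed matching forces \<open>v 0 = v 2 = v (-2)\<close> and, with
        \<open>e1\<close>, also \<open>e 0 = e 1\<close>, so the mirror equations hold here
        too.\<close>
      assume "w (-1) = w 1 \<and> w (-2) = w 0"
      then have "e (-1) = e 1 \<and> v (-1) * v 0 = v 1 * v 2" "e (-2) = e 0 \<and> v (-2) * v (-1) = v 0 * v 1"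
        using w_eqD[of "-1" 1] w_eqD[of "-2" 0] by simp_all
      moreover from this have "v 0 = v (-2)" "v 0 = v 2" using v12 by (auto simp: mult_ac)
      ultimately show ?thesis using v12 v23 e1 e2 by (auto simp: mult_ac)
    qed
  next
    case 8
    have w1: "w (-2) = w 1" using D(3)[of 1 1] 8 by (simp add: path_simps wrap)
    have w2: "w (-3) = w 2" using D(6)[of 1 1] 8 w1 by (simp add: path_simps wrap)
    have v12: "v (-1) * v (-2) = v 1 * v 2" using D(2) 8 by (simp add: path_simps wrap mult_ac)
    have "(v 1 * v 2) * v 3 = (v (-1) * v (-2)) * v (-3)" using D(5) 8 by (simp add: path_simps wrap mult_ac)
    then have v3: "v (-3) = v 3" by (simp add: v12)
    have "e 0 * e 1 * e 2 = e (-1) * e (-2) * e (-3)" using D(4) 8 by (simp add: path_simps wrap mult_ac)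
    then show ?thesis using w1 w2 v12 v3 W by auto
  next
    case 9
    have v1: "v (-1) = v 1" using D(2) 9 by (simp add: path_simps wrap)
    have v2: "v (-2) = v 2" using D(5) 9 by (simp add: path_simps wrap)
    have e1: "e (-2) = e 1" using D(4) 9 by (simp add: path_simps wrap)
    have w0: "w (-1) = w 0" using D(3)[of 1 1] 9 by (simp add: path_simps wrap)
    have w2: "w (-3) = w 2" using D(6)[of 1 1] 9 by (simp add: path_simps wrap)
    show ?thesis using v1 v2 e1 w0 w2 W by auto
  next
    case 10
    \<comment> \<open>For \<open>h = 3\<close> the shorter path is a single edge. This edge and the
      cancelled vertex products determine an edge weight through \<open>w_eqI\<close>, the converse
      of \<open>w_eqD\<close>.\<close>
    have "e (-3) = e 2" using D(4) 10 by (simp add: path_simps wrap)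
    moreover have "v (-3) * v (-2) = v 2 * v 3" using D(5) 10 by (simp add: path_simps wrap mult_ac)
    ultimately have w2: "w (-3) = w 2" using w_eqI[of "-3" 2] by simp
    have w1: "w (-2) = w 1" using D(6)[of 1 1] 10 w2 by (simp add: path_simps wrap)
    have "w (-1) = w 0" using D(6)[of 2 1] 10 w1 w2 by (simp add: path_simps wrap algebra_simps)
    then show ?thesis using w1 w2 by (rule all)
  next
    case 11
    have "e (-2) = e 1" using D(4) 11 by (simp add: path_simps wrap)
    moreover have "v (-2) * v (-1) = v 1 * v 2" using D(5) 11 by (simp add: path_simps wrap mult_ac)
    ultimately have w1: "w (-2) = w 1" using w_eqI[of "-2" 1] by simp
    have "w (-1) ^ j + w (-3) ^ j = w 0 ^ j + w 2 ^ j" for j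
      using D(6)[of 1 j] 11 w1 by (simp add: path_simps wrap add_ac)
    from two_powers[OF this] show ?thesis
    proof
      assume "w (-1) = w 0 \<and> w (-3) = w 2"
      then show ?thesis using w1 by (simp add: all)
    next
      assume w02: "w (-1) = w 2 \<and> w (-3) = w 0"
      \<comment> \<open>The 2-matchings make the two outer weights equal, so the crossed and the
        uncrossed matching coincide.\<close>
      then have "w 2 = w 0" using D(6)[of 2 1] 11 w1 by (simp add: path_simps wrap algebra_simps)
      with w02 w1 show ?thesis by (simp add: all)
    qed
  next
    case 12
    have "e (-1) = e 0" using D(4) 12 by (simp add: path_simps wrap)
    moreover have "v (-1) = v 1" using D(5) 12 by (simp add: path_simps wrap)
    ultimately have w0: "w (-1) = w 0" using w_eqI[of "-1" 0] by simp
    have w1: "w (-2) = w 1" using D(6)[of 1 1] 12 w0 by (simp add: path_simps wrap)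
    have "w (-3) = w 2" using D(6)[of 2 1] 12 w0 w1 by (simp add: path_simps wrap algebra_simps)
    with w0 w1 show ?thesis by (rule all)
  qed
qed

lemma mirror_5:
  assumes n: "n = 5" and h: "h \<in> {0, 1, 2}" and m: "m \<in> {1, 2}" and B: "balanced h m"
  shows "v (-1) = v 1 \<and> v (-2) = v 2 \<and> e (-1) = e 0 \<and> e (-2) = e 1"
    (is ?M)
proof -
  note period = v_period[unfolded n, simplified] e_period[unfolded n, simplified] w_period[unfolded n, simplified]
  note wrap = wrap_5[where f = v, OF period(1)] wrap_5[where f = e, OF period(2)] wrap_5[where f = w, OF period(3)]
  have "odd n" "2 * h < n" "n \<le> 7" using n h by auto
  note D = balancedD[OF this B, unfolded n]
  note W = w_eqD[of "-1" 0, simplified] w_eqD[of "-2" 1, simplified]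
  consider "h = 0" "m = 1" | "h = 0" "m = 2" | "h = 1" "m = 1" | "h = 1" "m = 2"
    | "h = 2" "m = 1" | "h = 2" "m = 2"
    using h m by blast
  then show ?thesis
  proof cases
    case 1
    have w0: "w (-1) = w 0" using D(3)[of 2 1] 1 by (simp add: path_simps wrap)
    have w1: "w (-2) = w 1" using D(3)[of 1 1] 1 w0 by (simp add: path_simps wrap)
    show ?thesis using w0 w1 W by auto
  next
    case 2
    have w1: "w (-2) = w 1" using D(3)[of 1 1] 2 by (simp add: path_simps wrap)
    have w0: "w (-1) = w 0" using D(3)[of 2 1] 2 w1 by (simp add: path_simps wrap)
    show ?thesis using w0 w1 W by auto
  next
    case 3
    have v1: "v (-1) = v 1" using D(5) 3 by (simp add: path_simps wrap)
    have w1: "w (-2) = w 1" using D(3)[of 1 1] 3 by (simp add: path_simps wrap)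
    have "e 0 * e 1 = e (-1) * e (-2)" using D(1) 3 by (simp add: path_simps wrap mult_ac)
    then show ?thesis using v1 w1 W by auto
  next
    case 4
    have v2: "v (-2) = v 2" using D(5) 4 by (simp add: path_simps wrap)
    have w0: "w (-1) = w 0" using D(3)[of 1 1] 4 by (simp add: path_simps wrap)
    have "e (-2) = e 1" using D(1) 4 by (simp add: path_simps wrap)
    then show ?thesis using v2 w0 W by auto
  next
    case 5
    have "e (-2) = e 1" using D(4) 5 by (simp add: path_simps wrap)
    moreover have "v (-2) * v (-1) = v 1 * v 2" using D(5) 5 by (simp add: path_simps wrap mult_ac)
    ultimately have w1: "w (-2) = w 1" using w_eqI[of "-2" 1] by simp
    have "w (-1) = w 0" using D(6)[of 1 1] 5 w1 by (simp add: path_simps wrap)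
    then show ?thesis using w1 W by auto
  next
    case 6
    have "e (-1) = e 0" using D(4) 6 by (simp add: path_simps wrap)
    moreover have "v (-1) = v 1" using D(5) 6 by (simp add: path_simps wrap)
    moreover from calculation have "w (-1) = w 0" using w_eqI[of "-1" 0] by simp
    then have "w (-2) = w 1" using D(6)[of 1 1] 6 by (simp add: path_simps wrap)
    ultimately show ?thesis using W by auto
  qed
qed

lemma mirror_3:
  assumes n: "n = 3" and h: "h \<in> {0, 1}" and B: "balanced h 1"
  shows "v (-1) = v 1 \<and> e (-1) = e 0"
proof -
  note period = v_period[unfolded n, simplified] e_period[unfolded n, simplified] w_period[unfolded n, simplified]
  note wrap = wrap_3[where f = v, OF period(1)] wrap_3[where f = e, OF period(2)] wrap_3[where f = w, OF period(3)]
  have "odd n" "2 * h < n" "n \<le> 7" using n h by auto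
  note D = balancedD[OF this B, unfolded n]
  show ?thesis
  proof (cases "h = 0")
    case True
    then have "w (-1) = w 0" using D(3)[of 1 1] by (simp add: path_simps wrap)
    then show ?thesis using w_eqD[of "-1" 0] by auto
  next
    case False
    then have "h = 1" using h by simp
    then show ?thesis using D(4,5) by (simp add: path_simps wrap)
  qed
qed

end

section \<open>From colors to prime weights and back\<close>

lemma periodic_mod:
  fixes f :: "int \<Rightarrow> 'b"
  assumes "\<And>k. f (k + p) = f k"
  shows "f (k mod p) = f k"
proof -
  have "f (k + q * p) = f k" for q k
  proof (induction q rule: int_induct[where k = 0])
    case (step1 i)
    then show ?case using assms[of "k + i * p"] by (simp add: algebra_simps)
  next
    case (step2 i)
    then show ?case using assms[of "k + (i - 1) * p"] by (simp add: algebra_simps)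
  qed simp
  from this[of "k mod p" "k div p"] show ?thesis by simp
qed

context cycle_weights
begin

text \<open>The lemmas for the single lengths cover the representatives near 0; periodicity reduces
  every \<open>t\<close> to its residue modulo \<open>n\<close>.\<close>

lemma mirror:
  assumes n: "n \<in> {3, 5, 7}" and h: "2 * h < n" and m: "0 < m" "2 * m < int n" and B: "balanced h m"
  shows "v (- t) = v t \<and> e (- 1 - t) = e t"
proof -
  have v: "v (- t) = v ((- (t mod int n)) mod int n)" "v t = v (t mod int n)"
    using periodic_mod[of v, OF v_period] by (simp_all add: mod_minus_eq)
  have "(- 1 - t) mod int n = (- 1 - t mod int n) mod int n" by (simp add: mod_diff_right_eq)
  then have e: "e (- 1 - t) = e ((- 1 - (t mod int n)) mod int n)" "e t = e (t mod int n)"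
    using periodic_mod[of e, OF e_period] by metis+
  note period = v_period e_period
  consider "n = 3" | "n = 5" | "n = 7" using n by auto
  then show ?thesis
  proof cases
    case 1
    have hm: "h \<in> {0, 1}" "m = 1" using 1 h m by auto
    note M = mirror_3[OF 1 hm(1) B[unfolded hm(2)]]
    note per = period[unfolded 1, simplified]
    note wrap = wrap_3[where f = v, OF per(1)] wrap_3[where f = e, OF per(2)]
    have "t mod int n = 0 \<or> t mod int n = 1 \<or> t mod int n = 2" using 1 by presburger
    then show ?thesis unfolding v e 1 using M by (auto simp: wrap)
  next
    case 2
    have hm: "h \<in> {0, 1, 2}" "m \<in> {1, 2}" using 2 h m by auto
    note M = mirror_5[OF 2 hm B]
    note per = period[unfolded 2, simplified]
    note wrap = wrap_5[where f = v, OF per(1)] wrap_5[where f = e, OF per(2)]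
    have "t mod int n = 0 \<or> t mod int n = 1 \<or> t mod int n = 2 \<or> t mod int n = 3 \<or> t mod int n = 4"
      using 2 by presburger
    then show ?thesis unfolding v e 2 using M by (auto simp: wrap)
  next
    case 3
    have hm: "h \<in> {0, 1, 2, 3}" "m \<in> {1, 2, 3}" using 3 h m by auto
    note M = mirror_7[OF 3 hm B]
    note per = period[unfolded 3, simplified]
    note wrap = wrap_7[where f = v, OF per(1)] wrap_7[where f = e, OF per(2)]
    have "t mod int n = 0 \<or> t mod int n = 1 \<or> t mod int n = 2 \<or> t mod int n = 3 \<or> t mod int n = 4
      \<or> t mod int n = 5 \<or> t mod int n = 6"
      using 3 by presburger
    then show ?thesis unfolding v e 3 using M by (auto simp: wrap)
  qed
qed

end

lemma ex_inj_prime: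
  assumes "finite S"
  shows "\<exists>p :: 'c \<Rightarrow> nat. inj_on p S \<and> (\<forall>x\<in>S. prime (p x))"
proof -
  obtain Q :: "nat set" where Q: "finite Q" "card Q = card S" "Q \<subseteq> {p. prime p}"
    using infinite_arbitrarily_large[OF primes_infinite] by blast
  obtain f where "bij_betw f S Q" using finite_same_card_bij[OF assms Q(1)] Q(2) by metis
  then show ?thesis using Q(3) by (auto simp: bij_betw_def)
qed

lemma periodic_range_finite:
  fixes f :: "int \<Rightarrow> 'b"
  assumes "\<And>k. f (k + p) = f k" "p > 0"
  shows "finite (range f)"
proof -
  have "f k \<in> f ` {0..<p}" for k
    using periodic_mod[of f p k, OF assms(1)] assms(2)
    by (metis atLeastLessThan_iff image_eqI pos_mod_bound pos_mod_sign)
  then have "range f \<subseteq> f ` {0..<p}" by blast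
  then show ?thesis by (rule finite_subset) simp
qed

text \<open>With distinct primes as weights and the origin moved to \<open>c\<close>, equal weights
  mean equal colors, so the mirror equations for weights translate back.\<close>

lemma colored_mirror:
  fixes V E :: "int \<Rightarrow> 'c"
  assumes n: "n \<in> {3, 5, 7}" and h: "2 * h < n" and m: "0 < m" "2 * m < int n"
    and per: "\<And>k. V (k + int n) = V k" "\<And>k. E (k + int n) = E k"
    and disj: "\<And>k l. V k \<noteq> E l"
    and H: "\<And>\<alpha> :: 'c \<Rightarrow> real. cyc_adj n (\<lambda>k. \<alpha> (V k)) (\<lambda>k. \<alpha> (E k)) (c + m - int h) (2 * h) =
      cyc_adj n (\<lambda>k. \<alpha> (V k)) (\<lambda>k. \<alpha> (E k)) (c - m - int h) (2 * h)"
  shows "V (c - t) = V (c + t) \<and> E (c - 1 - t) = E (c + t)"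
proof -
  have "finite (range V \<union> range E)"
    using periodic_range_finite[of V, OF per(1)] periodic_range_finite[of E, OF per(2)] n by auto
  then obtain p :: "'c \<Rightarrow> nat" where inj: "inj_on p (range V \<union> range E)"
    and "\<forall>x\<in>range V \<union> range E. prime (p x)" using ex_inj_prime by blast
  then have p: "prime (p (V k))" "prime (p (E k))" for k by auto
  define v where "v k = real (p (V (c + k)))" for k
  define e where "e k = real (p (E (c + k)))" for k
  interpret cycle_weights n v e
  proof
    show "v k > 0" "e k > 0" for k
      using p[of "c + k"] by (simp_all add: v_def e_def prime_gt_0_nat)
    show "v (k + int n) = v k" "e (k + int n) = e k" for k
      using per[of "c + k"] by (simp_all add: v_def e_def add.assoc)
    fix k l
    assume "(e k)\<^sup>2 * (v l * v (l + 1)) = (e l)\<^sup>2 * (v k * v (k + 1))"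
    then have "(p (E (c + k)))\<^sup>2 * (p (V (c + l)) * p (V (c + (l + 1)))) =
        (p (E (c + l)))\<^sup>2 * (p (V (c + k)) * p (V (c + (k + 1))))"
      unfolding v_def e_def by (simp flip: of_nat_mult of_nat_power)
    \<comment> \<open>The prime of the edge \<open>c + k\<close> divides the right-hand side; being
      no vertex prime, it must be the prime of the edge \<open>c + l\<close>.\<close>
    then have "p (E (c + k)) dvd (p (E (c + l)))\<^sup>2 * (p (V (c + k)) * p (V (c + (k + 1))))"
      by (metis dvd_triv_left dvd_mult2 power2_eq_square)
    then have "p (E (c + k)) = p (E (c + l)) \<or> p (E (c + k)) = p (V (c + k)) \<or> p (E (c + k)) = p (V (c + (k + 1)))"
      using p by (auto simp: prime_dvd_mult_iff prime_dvd_power_iff primes_dvd_imp_eq)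
    moreover have "p (E i) \<noteq> p (V j)" for i j
      using inj disj[of j i] by (auto dest!: inj_onD[where x = "E i" and y = "V j"])
    ultimately show "e k = e l" by (simp add: e_def)
  qed
  have "balanced h m"
    unfolding balanced_def
  proof (intro allI)
    fix a b :: nat and z :: real
    \<comment> \<open>Disjointness of vertex and edge colors lets a single assignment use different
      exponents for the two kinds and scale only the edges.\<close>
    define \<alpha> where "\<alpha> x = (if x \<in> range V then real (p x) ^ a else z * real (p x) ^ b)" for x
    have E_notin: "E k \<notin> range V" for k using disj by (metis rangeE)
    have "(\<lambda>k. v k ^ a) = (\<lambda>k. \<alpha> (V (c + k)))" "(\<lambda>k. z * e k ^ b) = (\<lambda>k. \<alpha> (E (c + k)))"
      using E_notin by (simp_all add: v_def e_def \<alpha>_def)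
    then show "cyc_adj n (\<lambda>k. v k ^ a) (\<lambda>k. z * e k ^ b) (m - int h) (2 * h) =
       cyc_adj n (\<lambda>k. v k ^ a) (\<lambda>k. z * e k ^ b) (- m - int h) (2 * h)"
      using H[of \<alpha>] cyc_adj_shift[where v = "\<lambda>k. \<alpha> (V k)" and e = "\<lambda>k. \<alpha> (E k)" and c = c]
      by (simp add: add_diff_eq)
  qed
  from mirror[OF n h m this, of t] have "p (V (c - t)) = p (V (c + t)) \<and> p (E (c - 1 - t)) = p (E (c + t))"
    unfolding v_def e_def by (simp add: add_diff_eq)
  then show ?thesis using inj_onD[OF inj] by blast
qed

text \<open>For small edge weights the shorter path dominates, and its length, the minimum of
  \<open>2 * h\<close> and \<open>n - 2 * h\<close>, determines \<open>h\<close> because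
  \<open>n\<close> is odd. The value \<open>1 / 10\<close> is small enough for the finitely many
  values to be distinct.\<close>

lemma cyc_adj_separates_distance:
  assumes n: "n \<in> {3, 5, 7}" and h: "2 * h < n" "2 * h' < n"
    and eq: "cyc_adj n (\<lambda>_. 1) (\<lambda>_. 1 / 10 :: real) s (2 * h) = cyc_adj n (\<lambda>_. 1) (\<lambda>_. 1 / 10) s' (2 * h')"
  shows "h = h'"
proof -
  consider "n = 3" | "n = 5" | "n = 7" using n by auto
  then show ?thesis
  proof cases
    case 1
    then have "h = 0 \<or> h = 1" "h' = 0 \<or> h' = 1" using h by auto
    then show ?thesis using eq unfolding 1 by (elim disjE) (simp_all add: cyc_adj_def numeral_eq_Suc)
  next
    case 2
    then have "h = 0 \<or> h = 1 \<or> h = 2" "h' = 0 \<or> h' = 1 \<or> h' = 2" using h by auto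
    then show ?thesis using eq unfolding 2 by (elim disjE) (simp_all add: cyc_adj_def numeral_eq_Suc)
  next
    case 3
    then have "h = 0 \<or> h = 1 \<or> h = 2 \<or> h = 3" "h' = 0 \<or> h' = 1 \<or> h' = 2 \<or> h' = 3" using h by auto
    then show ?thesis using eq unfolding 3 by (elim disjE) (simp_all add: cyc_adj_def numeral_eq_Suc)
  qed
qed

section \<open>Evaluation of polynomials\<close>

text \<open>Rational functions cannot be specialized everywhere; entries of the inverse are
  therefore compared as polynomials over a common denominator and only then evaluated at real
  numbers.\<close>

definition real_eval :: "('v \<Rightarrow> real) \<Rightarrow> 'v mpoly \<Rightarrow> real" where
  "real_eval \<alpha> p = (\<Sum>m \<in> Poly_Mapping.keys p.
     Poly_Mapping.lookup p m * (\<Prod>v \<in> Poly_Mapping.keys m. \<alpha> v ^ Poly_Mapping.lookup m v))"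

text \<open>Monomials may cancel in a sum of polynomials; over a common finite superset of the keys
  the sums can be added termwise.\<close>

lemma real_eval_superset:
  assumes "finite A" "Poly_Mapping.keys p \<subseteq> A"
  shows "real_eval \<alpha> p = (\<Sum>m \<in> A.
     Poly_Mapping.lookup p m * (\<Prod>v \<in> Poly_Mapping.keys m. \<alpha> v ^ Poly_Mapping.lookup m v))"
  unfolding real_eval_def using assms
  by (intro sum.mono_neutral_left) (auto simp: in_keys_iff)

lemma monomial_eval_add:
  fixes \<alpha> :: "'v \<Rightarrow> real"
  shows "(\<Prod>v \<in> Poly_Mapping.keys (m + m'). \<alpha> v ^ Poly_Mapping.lookup (m + m') v) =
    (\<Prod>v \<in> Poly_Mapping.keys m. \<alpha> v ^ Poly_Mapping.lookup m v) *
    (\<Prod>v \<in> Poly_Mapping.keys m'. \<alpha> v ^ Poly_Mapping.lookup m' v)"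
proof -
  let ?A = "Poly_Mapping.keys m \<union> Poly_Mapping.keys m'"
  have ext: "(\<Prod>v \<in> Poly_Mapping.keys l. \<alpha> v ^ Poly_Mapping.lookup l v) = (\<Prod>v \<in> ?A. \<alpha> v ^ Poly_Mapping.lookup l v)"
    if "Poly_Mapping.keys l \<subseteq> ?A" for l
    using that by (intro prod.mono_neutral_left) (auto simp: in_keys_iff)
  show ?thesis
    using ext[of m] ext[of m'] ext[of "m + m'"] Poly_Mapping.keys_add[of m m']
    by (simp add: lookup_add power_add prod.distrib)
qed

lemma real_eval_add: "real_eval \<alpha> (p + q) = real_eval \<alpha> p + real_eval \<alpha> q"
proof -
  let ?A = "Poly_Mapping.keys p \<union> Poly_Mapping.keys q"
  show ?thesis
    using real_eval_superset[of ?A p \<alpha>] real_eval_superset[of ?A q \<alpha>] real_eval_superset[of ?A "p + q" \<alpha>]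
      Poly_Mapping.keys_add[of p q]
    by (simp add: lookup_add distrib_right sum.distrib)
qed

lemma real_eval_single:
  "real_eval \<alpha> (Poly_Mapping.single m a) = a * (\<Prod>v \<in> Poly_Mapping.keys m. \<alpha> v ^ Poly_Mapping.lookup m v)"
  by (simp add: real_eval_def)

lemma real_eval_0: "real_eval \<alpha> 0 = 0"
  by (simp add: real_eval_def)

lemma real_eval_sum: "real_eval \<alpha> (\<Sum>x\<in>A. f x) = (\<Sum>x\<in>A. real_eval \<alpha> (f x))"
  by (induction A rule: infinite_finite_induct) (simp_all add: real_eval_0 real_eval_add)

lemma sum_singles: "(\<Sum>m\<in>Poly_Mapping.keys p. Poly_Mapping.single m (Poly_Mapping.lookup p m)) = p"
  by (rule poly_mapping_eqI) (auto simp: lookup_sum lookup_single when_def in_keys_iff)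

lemma real_eval_mult: "real_eval \<alpha> (p * q) = real_eval \<alpha> p * real_eval \<alpha> q"
proof -
  let ?f = "\<lambda>p m. Poly_Mapping.single m (Poly_Mapping.lookup p m)"
  have "p * q = (\<Sum>m\<in>Poly_Mapping.keys p. \<Sum>m'\<in>Poly_Mapping.keys q. ?f p m * ?f q m')"
    by (simp add: sum_singles flip: sum_product)
  then have "real_eval \<alpha> (p * q) =
     (\<Sum>m\<in>Poly_Mapping.keys p. \<Sum>m'\<in>Poly_Mapping.keys q. real_eval \<alpha> (?f p m) * real_eval \<alpha> (?f q m'))"
    by (simp add: real_eval_sum mult_single real_eval_single monomial_eval_add mult_ac)
  also have "\<dots> = (\<Sum>m\<in>Poly_Mapping.keys p. real_eval \<alpha> (?f p m)) * (\<Sum>m'\<in>Poly_Mapping.keys q. real_eval \<alpha> (?f q m'))"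
    by (simp add: sum_product)
  also have "\<dots> = real_eval \<alpha> p * real_eval \<alpha> q"
    by (simp only: real_eval_sum[symmetric] sum_singles)
  finally show ?thesis .
qed

lemma real_eval_mvar: "real_eval \<alpha> (mvar v) = \<alpha> v"
  by (simp add: mvar_def real_eval_single)

interpretation real_eval: comm_ring_hom "real_eval \<alpha>"
  by unfold_locales (simp_all add: real_eval_0 real_eval_add real_eval_mult real_eval_def[of \<alpha> 1])

context comm_ring_hom
begin

lemma hom_continuant: "hom (continuant v e s l) = continuant (\<lambda>k. hom (v k)) (\<lambda>k. hom (e k)) s l"
  by (induction v e s l rule: continuant.induct) (simp_all add: hom_distribs)

lemma hom_cyc_adj: "hom (cyc_adj n v e s l) = cyc_adj n (\<lambda>k. hom (v k)) (\<lambda>k. hom (e k)) s l"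
  by (simp add: cyc_adj_def hom_distribs hom_continuant)

lemma hom_cyc_det: "hom (cyc_det n v e s) = cyc_det n (\<lambda>k. hom (v k)) (\<lambda>k. hom (e k)) s"
  by (simp add: cyc_det_def hom_distribs hom_cyc_adj)

end

lemma cyc_det_edgeless:
  assumes "0 < n"
  shows "cyc_det n (\<lambda>_. 1) (\<lambda>_. 0) s = 1"
proof -
  have "continuant (\<lambda>_. 1) (\<lambda>_. 0) s (Suc l) = 1" for s l
    by (induction l arbitrary: s) simp_all
  then show ?thesis using assms by (cases n) (simp_all add: cyc_det_def cyc_adj_def)
qed

text \<open>Both row expansions are multiplied out for each length, after the origin is moved to
  \<open>s\<close> so that four wrap-around equations suffice. This gives the same diagonal entry of
  adjugate times matrix in every row.\<close>

lemma cyc_det_Suc: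
  fixes v e :: "int \<Rightarrow> 'a::comm_ring_1"
  assumes "n \<in> {3, 5, 7}" and v: "\<And>k. v (k + int n) = v k" and e: "\<And>k. e (k + int n) = e k"
  shows "cyc_det n v e (s + 1) = cyc_det n v e s"
proof -
  define V where "V k = v (s + k)" for k
  define E where "E k = e (s + k)" for k
  have per: "V (k + int n) = V k" "E (k + int n) = E k" for k
    using v[of "s + k"] e[of "s + k"] by (simp_all add: V_def E_def add.assoc)
  have sh: "cyc_det n v e (s + t) = cyc_det n V E t" for t
    unfolding V_def E_def by (rule cyc_det_shift[symmetric])
  have wrap: "V (int n) = V 0" "V (1 + int n) = V 1" "E (int n) = E 0"  "E (int n - 1) = E (- 1)"
    using per(1)[of 0] per(1)[of 1] per(2)[of 0] per(2)[of "-1"] by simp_all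
  have "cyc_det n V E 1 = cyc_det n V E 0"
    using assms(1)
    apply (elim insertE emptyE)
    using wrap
    apply (simp_all add: cyc_det_def cyc_adj_def numeral_eq_Suc lessThan_Suc prod.atLeast_Suc_lessThan)
    apply (simp_all add: algebra_simps power2_eq_square)
    done
  then show ?thesis using sh[of 1] sh[of 0] by simp
qed

section \<open>Permutation matrices\<close>

text \<open>A left inverse of a square matrix is two-sided, and a two-sided inverse is unique, so
  the description in \<open>inv_mat\<close> denotes \<open>B\<close>.\<close>

lemma inv_matI:
  fixes A B :: "'a::field mat"
  assumes A: "A \<in> carrier_mat n n" and B: "B \<in> carrier_mat n n" and BA: "B * A = 1\<^sub>m n"
  shows "inv_mat A = B"
  unfolding inv_mat_def
proof (rule the_equality)
  have AB: "A * B = 1\<^sub>m n" by (rule mat_mult_left_right_inverse[OF B A BA])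
  show "inverts_mat A B \<and> inverts_mat B A"
    using A B AB BA by (simp add: inverts_mat_def)
  fix C
  assume C: "inverts_mat A C \<and> inverts_mat C A"
  then have AC: "A * C = 1\<^sub>m n" and CA: "C * A = 1\<^sub>m (dim_row C)"
    using A by (simp_all add: inverts_mat_def)
  \<comment> \<open>\<open>inverts_mat\<close> leaves the dimensions of \<open>C\<close> open; the
    two products fix them.\<close>
  have "dim_col C = n" using AC by (metis index_mult_mat(3) index_one_mat(3))
  moreover have "dim_row C = n" using CA A by (metis index_mult_mat(3) index_one_mat(3) carrier_matD(2))
  ultimately have "C \<in> carrier_mat n n" by auto
  have "C = B * A * C" using \<open>C \<in> carrier_mat n n\<close> by (simp add: BA)
  also have "\<dots> = B * (A * C)" by (rule assoc_mult_mat[OF B A \<open>C \<in> carrier_mat n n\<close>])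
  also have "\<dots> = B" using B by (simp add: AC)
  finally show "C = B" .
qed

lemma inv_perm_mat:
  assumes "\<pi> permutes {..<n}"
  shows "perm_mat n (inv_into UNIV \<pi>) * (perm_mat n \<pi> :: 'a::field mat) = 1\<^sub>m n"
    and "inv_mat (perm_mat n \<pi> :: 'a mat) = perm_mat n (inv_into UNIV \<pi>)"
proof -
  have lt: "\<pi> j < n" if "j < n" for j using permutes_in_image[OF assms] that by auto
  have inv: "i = inv_into UNIV \<pi> r \<longleftrightarrow> r = \<pi> i" for i r using permutes_inverses[OF assms] by metis
  show *: "perm_mat n (inv_into UNIV \<pi>) * (perm_mat n \<pi> :: 'a mat) = 1\<^sub>m n"
  proof (rule eq_matI)
    fix i j
    assume "i < dim_row (1\<^sub>m n :: 'a mat)" "j < dim_col (1\<^sub>m n :: 'a mat)"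
    then have ij: "i < n" "j < n" by auto
    have "(perm_mat n (inv_into UNIV \<pi>) * perm_mat n \<pi> :: 'a mat) $$ (i, j) =
        (\<Sum>r = 0..<n. (if r = \<pi> i then 1 else 0) * (if r = \<pi> j then 1 else 0))"
      using ij by (simp add: perm_mat_def scalar_prod_def inv)
    also have "\<dots> = (\<Sum>r = 0..<n. if r = \<pi> i then (if i = j then 1 else 0) else 0)"
      using permutes_inj[OF assms] by (intro sum.cong) (auto dest: injD)
    also have "\<dots> = (if i = j then 1 else 0)" using lt[OF ij(1)] by simp
    finally show "(perm_mat n (inv_into UNIV \<pi>) * perm_mat n \<pi> :: 'a mat) $$ (i, j) = 1\<^sub>m n $$ (i, j)"
      using ij by simp
  qed (simp_all add: perm_mat_def)
  show "inv_mat (perm_mat n \<pi> :: 'a mat) = perm_mat n (inv_into UNIV \<pi>)"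
    by (rule inv_matI[OF _ _ *]) (simp_all add: perm_mat_def)
qed

lemma conc_mat_carrier: "conc_mat n cv ce \<in> carrier_mat n n"
  by (simp add: conc_mat_def)

text \<open>As the permutation matrix \<open>P\<close> is invertible, the condition reads
  \<open>P * K = K * P\<close>. At position \<open>(\<pi> i, j)\<close> the left side has the entry
  of \<open>K\<close> at \<open>(i, j)\<close>, the right side that at
  \<open>(\<pi> i, \<pi> j)\<close>, and \<pi> reaches every row.\<close>

lemma graph_symmetry_iff:
  "graph_symmetry n cv ce \<pi> \<longleftrightarrow> \<pi> permutes {..<n} \<and>
    (\<forall>i<n. \<forall>j<n. conc_mat n cv ce $$ (\<pi> i, \<pi> j) = conc_mat n cv ce $$ (i, j))"
proof (cases "\<pi> permutes {..<n}")
  case True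
  note K = conc_mat_carrier[of n cv ce]
  let ?K = "conc_mat n cv ce" and ?P = "perm_mat n \<pi> :: 'a ratfun mat" and ?Q = "perm_mat n (inv_into UNIV \<pi>) :: 'a ratfun mat"
  have P: "?P \<in> carrier_mat n n" "?Q \<in> carrier_mat n n" by (simp_all add: perm_mat_def)
  have QP: "?Q * ?P = 1\<^sub>m n" and inv: "inv_mat ?P = ?Q" using inv_perm_mat[OF True] by auto
  have PQ: "?P * ?Q = 1\<^sub>m n" by (rule mat_mult_left_right_inverse[OF P(2,1) QP])
  have lt: "\<pi> j < n" if "j < n" for j using permutes_in_image[OF True] that by auto
  have "?P * ?K * ?Q = ?K \<longleftrightarrow> ?P * ?K = ?K * ?P"
  proof
    assume "?P * ?K * ?Q = ?K"
    then have "?K * ?P = ?P * ?K * ?Q * ?P" by simp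
    also have "\<dots> = ?P * ?K * (?Q * ?P)" using P K by (intro assoc_mult_mat) auto
    also have "\<dots> = ?P * ?K" using P K by (simp add: QP)
    finally show "?P * ?K = ?K * ?P" by simp
  next
    assume "?P * ?K = ?K * ?P"
    then have "?P * ?K * ?Q = ?K * ?P * ?Q" by simp
    also have "\<dots> = ?K * (?P * ?Q)" using P K by (intro assoc_mult_mat) auto
    also have "\<dots> = ?K" using P K by (simp add: PQ)
    finally show "?P * ?K * ?Q = ?K" .
  qed
  also have "\<dots> \<longleftrightarrow> (\<forall>i<n. \<forall>j<n. (?P * ?K) $$ (\<pi> i, j) = (?K * ?P) $$ (\<pi> i, j))"
  proof
    assume *: "\<forall>i<n. \<forall>j<n. (?P * ?K) $$ (\<pi> i, j) = (?K * ?P) $$ (\<pi> i, j)"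
    show "?P * ?K = ?K * ?P"
    proof (rule eq_matI)
      fix i j
      assume "i < dim_row (?K * ?P)" "j < dim_col (?K * ?P)"
      then have ij: "i < n" "j < n" using P K by auto
      obtain k where "k < n" "i = \<pi> k"
        using ij(1) permutes_image[OF True] by (metis imageE lessThan_iff)
      with * ij show "(?P * ?K) $$ (i, j) = (?K * ?P) $$ (i, j)" by blast
    qed (use P K in auto)
  qed simp
  also have "\<dots> \<longleftrightarrow> (\<forall>i<n. \<forall>j<n. ?K $$ (\<pi> i, \<pi> j) = ?K $$ (i, j))"
  proof -
    have "(?P * ?K) $$ (\<pi> i, j) = ?K $$ (i, j)" if "i < n" "j < n" for i j
    proof -
      have "(?P * ?K) $$ (\<pi> i, j) = (\<Sum>r = 0..<n. (if \<pi> i = \<pi> r then 1 else 0) * ?K $$ (r, j))"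
        using that lt K by (simp add: perm_mat_def scalar_prod_def)
      also have "\<dots> = (\<Sum>r = 0..<n. if r = i then ?K $$ (i, j) else 0)"
        using permutes_inj[OF True] by (intro sum.cong) (auto dest: injD)
      finally show ?thesis using that by simp
    qed
    moreover have "(?K * ?P) $$ (\<pi> i, j) = ?K $$ (\<pi> i, \<pi> j)" if "i < n" "j < n" for i j
    proof -
      have "(?K * ?P) $$ (\<pi> i, j) = (\<Sum>r = 0..<n. ?K $$ (\<pi> i, r) * (if r = \<pi> j then 1 else 0))"
        using that lt K by (simp add: perm_mat_def scalar_prod_def)
      also have "\<dots> = (\<Sum>r = 0..<n. if r = \<pi> j then ?K $$ (\<pi> i, \<pi> j) else 0)"
        by (intro sum.cong) auto
      finally show ?thesis using that lt by simp
    qed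
    ultimately show ?thesis by auto
  qed
  finally show ?thesis using True by (simp add: graph_symmetry_def inv)
qed (simp add: graph_symmetry_def)

section \<open>The inverse of the concentration matrix\<close>

text \<open>Extending the colors periodically to the integers lets paths run across the vertex 0
  without case distinctions.\<close>

definition vcol :: "nat \<Rightarrow> (nat \<Rightarrow> 'c) \<Rightarrow> int \<Rightarrow> 'c" where
  "vcol n cv k = cv (nat (k mod int n))"

definition ecol :: "nat \<Rightarrow> (nat set \<Rightarrow> 'c) \<Rightarrow> int \<Rightarrow> 'c" where
  "ecol n ce k = ce {nat (k mod int n), nat ((k + 1) mod int n)}"

lemma vcol_period: "vcol n cv (k + int n) = vcol n cv k"
  by (simp add: vcol_def)

lemma ecol_period: "ecol n ce (k + int n) = ecol n ce k"
proof -
  have "(k + int n + 1) mod int n = (k + 1) mod int n"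
    using mod_add_self2[of "k + 1" "int n"] by (simp add: ac_simps)
  then show ?thesis by (simp add: ecol_def)
qed

lemma nat_mod_Suc:
  assumes "0 < n"
  shows "nat ((k + 1) mod int n) = Suc (nat (k mod int n)) mod n"
proof -
  have "(k + 1) mod int n = int (Suc (nat (k mod int n)) mod n)"
    using assms by (simp add: zmod_int mod_add_right_eq add.commute)
  then show ?thesis by simp
qed

lemma vcol_neq_ecol:
  assumes "colored_cycle n cv ce"
  shows "vcol n cv k \<noteq> ecol n ce l"
proof -
  have n: "0 < n" "cv ` {..<n} \<inter> ce ` cycle_edges n = {}"
    using assms by (auto simp: colored_cycle_def)
  have "nat (k mod int n) < n" "nat (l mod int n) < n" using n(1) by (simp_all add: nat_less_iff)
  then have "vcol n cv k \<in> cv ` {..<n}" "ecol n ce l \<in> ce ` cycle_edges n"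
    unfolding vcol_def ecol_def nat_mod_Suc[OF n(1)] cycle_edges_def by auto
  then show ?thesis using n(2) by (metis IntI empty_iff)
qed

lemma cycle_edges_iff:
  assumes "i < n" "j < n"
  shows "{i, j} \<in> cycle_edges n \<longleftrightarrow> j = Suc i mod n \<or> i = Suc j mod n"
  using assms by (auto simp: cycle_edges_def doubleton_eq_iff)

text \<open>Column \<open>j\<close> is supported on \<open>j\<close> and its two neighbours, which
  are distinct as \<open>3 \<le> n\<close>. The predecessor is written with \<open>n - 1\<close>
  added, since subtraction of natural numbers truncates at 0.\<close>

lemma sum_conc_mat:
  fixes f :: "nat \<Rightarrow> 'c::linorder ratfun"
  assumes n: "3 \<le> n" and j: "j < n"
  shows "(\<Sum>r<n. f r * conc_mat n cv ce $$ (r, j)) =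
    f j * indet (vcol n cv (int j)) + f (Suc j mod n) * indet (ecol n ce (int j))
    + f ((j + (n - 1)) mod n) * indet (ecol n ce (int j - 1))"
proof -
  define a where "a = Suc j mod n"
  define b where "b = (j + (n - 1)) mod n"
  have a: "a = (if Suc j = n then 0 else Suc j)" using j by (auto simp: a_def)
  have b: "b = (if j = 0 then n - 1 else j - 1)"
  proof (cases "j = 0")
    case False
    then have eq: "j + (n - 1) = (j - 1) + n" using n by simp
    have "b = (j - 1) mod n" unfolding b_def eq by (rule mod_add_self2)
    then show ?thesis using j False by simp
  qed (use n in \<open>simp add: b_def\<close>)
  have dist: "a < n" "b < n" "a \<noteq> j" "b \<noteq> j" "a \<noteq> b" "Suc b mod n = j" using n j by (auto simp: a b)
  have bi: "r = b" if "r < n" "j = Suc r mod n" for r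
    using that n j by (cases "Suc r = n") (auto simp: b)
  have vj: "vcol n cv (int j) = cv j" using j by (simp add: vcol_def)
  have n0: "0 < n" using n by simp
  have ej: "ecol n ce (int j) = ce {a, j}"
    using j unfolding ecol_def nat_mod_Suc[OF n0] by (simp add: a_def insert_commute)
  have "(int j - 1) mod int n = int b"
  proof -
    have "(int j - 1) mod int n = (int j - 1 + int n) mod int n" by simp
    also have "int j - 1 + int n = int (j + (n - 1))" using n by simp
    finally show ?thesis by (simp add: b_def zmod_int)
  qed
  then have eb: "ecol n ce (int j - 1) = ce {b, j}"
    using j by (simp add: ecol_def)
  have K: "conc_mat n cv ce $$ (r, j) = (if r = j then indet (cv j) else if {r, j} \<in> cycle_edges n then indet (ce {r, j}) else 0)"
    if "r < n" for r
    using that j by (simp add: conc_mat_def)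
  have zero: "conc_mat n cv ce $$ (r, j) = 0" if "r < n" "r \<notin> {j, a, b}" for r
    using that bi[OF that(1)] j unfolding K[OF that(1)] by (auto simp: cycle_edges_iff a_def)
  have "(\<Sum>r<n. f r * conc_mat n cv ce $$ (r, j)) = (\<Sum>r\<in>{j, a, b}. f r * conc_mat n cv ce $$ (r, j))"
    using j dist zero by (intro sum.mono_neutral_right) auto
  also have "\<dots> = f j * conc_mat n cv ce $$ (j, j) + f a * conc_mat n cv ce $$ (a, j) + f b * conc_mat n cv ce $$ (b, j)"
    using dist by (simp add: add_ac)
  also have "conc_mat n cv ce $$ (j, j) = indet (cv j)" using j by (simp add: K)
  also have "conc_mat n cv ce $$ (a, j) = indet (ce {a, j})"
    using dist j by (simp add: K cycle_edges_iff a_def)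
  also have "conc_mat n cv ce $$ (b, j) = indet (ce {b, j})"
    using dist j by (simp add: K cycle_edges_iff)
  finally show ?thesis by (simp add: vj ej eb a_def b_def)
qed

definition adj_poly :: "nat \<Rightarrow> (nat \<Rightarrow> 'c::linorder) \<Rightarrow> (nat set \<Rightarrow> 'c) \<Rightarrow> int \<Rightarrow> nat \<Rightarrow> 'c mpoly" where
  "adj_poly n cv ce = cyc_adj n (\<lambda>k. mvar (vcol n cv k)) (\<lambda>k. mvar (ecol n ce k))"

definition det_poly :: "nat \<Rightarrow> (nat \<Rightarrow> 'c::linorder) \<Rightarrow> (nat set \<Rightarrow> 'c) \<Rightarrow> 'c mpoly" where
  "det_poly n cv ce = cyc_det n (\<lambda>k. mvar (vcol n cv k)) (\<lambda>k. mvar (ecol n ce k)) 0"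

lemma real_eval_adj_poly:
  "real_eval \<alpha> (adj_poly n cv ce s l) = cyc_adj n (\<lambda>k. \<alpha> (vcol n cv k)) (\<lambda>k. \<alpha> (ecol n ce k)) s l"
  by (simp add: adj_poly_def real_eval.hom_cyc_adj real_eval_mvar)

lemma det_poly_nonzero:
  assumes "colored_cycle n cv ce"
  shows "det_poly n cv ce \<noteq> 0"
proof
  assume "det_poly n cv ce = 0"
  moreover define \<alpha> where "\<alpha> x = (if x \<in> range (vcol n cv) then 1 else 0 :: real)" for x
  have "ecol n ce k \<notin> range (vcol n cv)" for k using vcol_neq_ecol[OF assms] by (metis rangeE)
  then have "real_eval \<alpha> (det_poly n cv ce) = cyc_det n (\<lambda>_. 1) (\<lambda>_. 0) 0"
    by (simp add: det_poly_def real_eval.hom_cyc_det real_eval_mvar \<alpha>_def)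
  moreover have "0 < n" using assms by (simp add: colored_cycle_def)
  ultimately show False by (simp add: cyc_det_edgeless real_eval_0)
qed

lemma cyc_det_poly:
  assumes "n \<in> {3, 5, 7}"
  shows "cyc_det n (\<lambda>k. mvar (vcol n cv k)) (\<lambda>k. mvar (ecol n ce k)) (int i) = det_poly n cv ce"
proof (induction i)
  case (Suc i)
  then show ?case
    using cyc_det_Suc[OF assms, of "\<lambda>k. mvar (vcol n cv k)" "\<lambda>k. mvar (ecol n ce k)" "int i"]
    by (simp add: vcol_period ecol_period add.commute)
qed (simp add: det_poly_def)

text \<open>Here \<open>l\<close> counts the forward steps from \<open>i\<close> to
  \<open>j\<close>. For \<open>l = 0\<close> the left side is the expansion of the determinant along
  row \<open>i\<close>, otherwise it vanishes by \<open>cyc_adj_row\<close>.\<close>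

lemma adj_poly_row:
  assumes n: "n \<in> {3, 5, 7}" and i: "i < n" and j: "j < n"
  defines "l \<equiv> (j + (n - i)) mod n"
  shows "adj_poly n cv ce (int i) l * mvar (vcol n cv (int j))
    + adj_poly n cv ce (int i) (Suc l mod n) * mvar (ecol n ce (int j))
    + adj_poly n cv ce (int i) ((l + (n - 1)) mod n) * mvar (ecol n ce (int j - 1))
    = (if i = j then det_poly n cv ce else 0)"
proof -
  let ?v = "\<lambda>k. mvar (vcol n cv k)" and ?e = "\<lambda>k. mvar (ecol n ce k)"
  have l: "l < n" using i by (simp add: l_def)
  have l_cases: "l = (if i \<le> j then j - i else j + n - i)"
    using i j by (auto simp: l_def mod_if)
  have "(int i + int l) mod int n = int j mod int n" using i j by (auto simp: l_cases)
  then obtain q where q: "int i + int l = int j + q * int n" by (metis mod_eqE mult.commute diff_eq_eq add.commute)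
  have per: "?v (k + q * int n) = ?v k" "?e (k + q * int n) = ?e k" for k
    using periodic_mod[of ?v "int n" k] periodic_mod[of ?v "int n" "k + q * int n"]
      periodic_mod[of ?e "int n" k] periodic_mod[of ?e "int n" "k + q * int n"]
    by (simp_all add: vcol_period ecol_period)
  have V: "?v (int j) = ?v (int i + int l)" "?e (int j) = ?e (int i + int l)" "?e (int j - 1) = ?e (int i + int l - 1)"
    using per(1)[of "int j"] per(2)[of "int j"] per(2)[of "int j - 1"] by (simp_all add: q algebra_simps)
  show ?thesis
  proof (cases "l = 0")
    case True
    then have "i = j" using i j by (auto simp: l_cases split: if_splits)
    then show ?thesis
      using cyc_det_poly[OF n, of cv ce i] n True unfolding V
      by (auto simp: adj_poly_def cyc_det_def mult_ac)
  next
    case False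
    then have "i \<noteq> j" using i j by (auto simp: l_cases)
    \<comment> \<open>At \<open>l = n - 1\<close> the successor wraps around to 0, where
      \<open>cyc_adj\<close> has the same value as at \<open>n\<close>.\<close>
    moreover have "adj_poly n cv ce (int i) (Suc l mod n) = adj_poly n cv ce (int i) (Suc l)"
      using l by (cases "Suc l = n") (auto simp: adj_poly_def cyc_adj_wrap)
    moreover have "(l + (n - 1)) mod n = l - 1"
    proof -
      have eq: "l + (n - 1) = (l - 1) + n" using False n by auto
      show ?thesis unfolding eq mod_add_self2 using l by simp
    qed
    ultimately show ?thesis
      using cyc_adj_row[of l n ?v "int i" ?e] False l unfolding V by (simp add: adj_poly_def ac_simps)
  qed
qed

definition conc_inv :: "nat \<Rightarrow> (nat \<Rightarrow> 'c::linorder) \<Rightarrow> (nat set \<Rightarrow> 'c) \<Rightarrow> 'c ratfun mat" where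
  "conc_inv n cv ce = mat n n (\<lambda>(i, j).
     to_fract (adj_poly n cv ce (int i) ((j + (n - i)) mod n)) / to_fract (det_poly n cv ce))"

lemma conc_inv_carrier: "conc_inv n cv ce \<in> carrier_mat n n"
  by (simp add: conc_inv_def)

lemma conc_inv_mult:
  assumes n: "n \<in> {3, 5, 7}" and G: "colored_cycle n cv ce"
  shows "conc_inv n cv ce * conc_mat n cv ce = 1\<^sub>m n"
proof (rule eq_matI)
    fix i j
    assume "i < dim_row (1\<^sub>m n :: 'a ratfun mat)" "j < dim_col (1\<^sub>m n :: 'a ratfun mat)"
    then have ij: "i < n" "j < n" by auto
    let ?l = "(j + (n - i)) mod n"
    let ?D = "to_fract (det_poly n cv ce)"
    let ?F = "\<lambda>l. to_fract (adj_poly n cv ce (int i) l)"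
    have n3: "3 \<le> n" using n by auto
    have "(conc_inv n cv ce * conc_mat n cv ce) $$ (i, j) = (\<Sum>r<n. ?F ((r + (n - i)) mod n) / ?D * conc_mat n cv ce $$ (r, j))"
      using ij carrier_matD[OF conc_mat_carrier[of n cv ce]]
      by (simp add: scalar_prod_def lessThan_atLeast0 conc_inv_def)
    also have "\<dots> = ?F ?l / ?D * indet (vcol n cv (int j))
      + ?F ((Suc j mod n + (n - i)) mod n) / ?D * indet (ecol n ce (int j))
      + ?F (((j + (n - 1)) mod n + (n - i)) mod n) / ?D * indet (ecol n ce (int j - 1))"
      by (rule sum_conc_mat[OF n3 ij(2)])
    also have "(Suc j mod n + (n - i)) mod n = Suc ?l mod n" by (simp add: mod_add_left_eq mod_Suc_eq)
    also have "((j + (n - 1)) mod n + (n - i)) mod n = (?l + (n - 1)) mod n"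
    unfolding mod_add_left_eq by (simp only: ac_simps)
    also have "?F ?l / ?D * indet (vcol n cv (int j)) + ?F (Suc ?l mod n) / ?D * indet (ecol n ce (int j))
      + ?F ((?l + (n - 1)) mod n) / ?D * indet (ecol n ce (int j - 1))
      = to_fract (adj_poly n cv ce (int i) ?l * mvar (vcol n cv (int j))
    + adj_poly n cv ce (int i) (Suc ?l mod n) * mvar (ecol n ce (int j))
    + adj_poly n cv ce (int i) ((?l + (n - 1)) mod n) * mvar (ecol n ce (int j - 1))) / ?D"
      by (simp add: indet_def add_divide_distrib)
    also have "\<dots> = (if i = j then 1 else 0)"
      unfolding adj_poly_row[OF n ij] using det_poly_nonzero[OF G] by simp
    finally show "(conc_inv n cv ce * conc_mat n cv ce) $$ (i, j) = 1\<^sub>m n $$ (i, j)" using ij by simp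
qed (simp_all add: conc_mat_def conc_inv_def)

lemma inv_conc_mat:
  assumes "n \<in> {3, 5, 7}" and "colored_cycle n cv ce"
  shows "inv_mat (conc_mat n cv ce) = conc_inv n cv ce"
  by (rule inv_matI[OF conc_mat_carrier conc_inv_carrier conc_inv_mult[OF assms]])

lemma left_inverse_unique:
  fixes A :: "'a::field mat"
  assumes "A \<in> carrier_mat n n" "B \<in> carrier_mat n n" "C \<in> carrier_mat n n"
    and "B * A = 1\<^sub>m n" "C * A = 1\<^sub>m n"
  shows "B = C"
  using inv_matI[OF assms(1,2,4)] inv_matI[OF assms(1,3,5)] by simp

text \<open>The cofactor formula treats \<open>i\<close> and \<open>j\<close> differently. Symmetry
  comes from the concentration matrix instead: the transpose of its inverse is again a left
  inverse.\<close>

lemma conc_inv_sym: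
  assumes n: "n \<in> {3, 5, 7}" and G: "colored_cycle n cv ce" and ij: "i < n" "j < n"
  shows "conc_inv n cv ce $$ (j, i) = conc_inv n cv ce $$ (i, j)"
proof -
  let ?K = "conc_mat n cv ce" and ?B = "conc_inv n cv ce"
  note c = conc_mat_carrier[of n cv ce] conc_inv_carrier[of n cv ce]
  have T: "?K\<^sup>T = ?K"
    by (rule eq_matI) (auto simp: conc_mat_def insert_commute)
  have "?K * ?B = 1\<^sub>m n" by (rule mat_mult_left_right_inverse[OF c(2,1) conc_inv_mult[OF n G]])
  then have "(?K * ?B)\<^sup>T = 1\<^sub>m n" by simp
  then have "?B\<^sup>T * ?K = 1\<^sub>m n" using transpose_mult[OF c] by (simp add: T)
  then have "?B\<^sup>T = ?B"
    using left_inverse_unique[OF c(1) _ c(2) _ conc_inv_mult[OF n G]] c by simp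
  moreover have "?B\<^sup>T $$ (i, j) = ?B $$ (j, i)" using ij c by (auto simp: transpose_mat_def)
  ultimately show ?thesis by simp
qed

text \<open>Permuting rows and columns by a symmetry turns the inverse into another left inverse of
  the same matrix.\<close>

lemma conc_inv_symmetry:
  assumes n: "n \<in> {3, 5, 7}" and G: "colored_cycle n cv ce" and sym: "graph_symmetry n cv ce \<pi>"
    and ij: "i < n" "j < n"
  shows "conc_inv n cv ce $$ (\<pi> i, \<pi> j) = conc_inv n cv ce $$ (i, j)"
proof -
  let ?K = "conc_mat n cv ce" and ?B = "conc_inv n cv ce"
  note c = conc_mat_carrier[of n cv ce] conc_inv_carrier[of n cv ce]
  have K: "?K $$ (\<pi> i, \<pi> j) = ?K $$ (i, j)" if "i < n" "j < n" for i j
    using sym that unfolding graph_symmetry_iff by auto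
  have perm: "\<pi> permutes {..<n}" using sym unfolding graph_symmetry_iff by auto
  have lt: "\<pi> j < n" if "j < n" for j using permutes_in_image[OF perm] that by auto
  define C where "C = mat n n (\<lambda>(i, j). ?B $$ (\<pi> i, \<pi> j))"
  have "C * ?K = 1\<^sub>m n"
  proof (rule eq_matI)
    fix i j
    assume "i < dim_row (1\<^sub>m n :: 'a ratfun mat)" "j < dim_col (1\<^sub>m n :: 'a ratfun mat)"
    then have ij: "i < n" "j < n" by auto
    have "(C * ?K) $$ (i, j) = (\<Sum>r<n. ?B $$ (\<pi> i, \<pi> r) * ?K $$ (r, j))"
      using ij c by (simp add: C_def scalar_prod_def lessThan_atLeast0)
    also have "\<dots> = (\<Sum>r<n. ?B $$ (\<pi> i, \<pi> r) * ?K $$ (\<pi> r, \<pi> j))"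
      using ij by (intro sum.cong) (auto simp: K)
    also have "\<dots> = (\<Sum>r<n. ?B $$ (\<pi> i, r) * ?K $$ (r, \<pi> j))"
      using sum.permute[OF perm, of "\<lambda>r. ?B $$ (\<pi> i, r) * ?K $$ (r, \<pi> j)"] by (simp add: o_def)
    also have "\<dots> = (?B * ?K) $$ (\<pi> i, \<pi> j)"
      using lt ij c by (simp add: scalar_prod_def lessThan_atLeast0)
    also have "\<dots> = 1\<^sub>m n $$ (i, j)"
      using lt ij permutes_inj[OF perm] by (auto simp: conc_inv_mult[OF n G] dest: injD)
    finally show "(C * ?K) $$ (i, j) = 1\<^sub>m n $$ (i, j)" .
  qed (use c in \<open>auto simp: C_def\<close>)
  moreover have "C \<in> carrier_mat n n" by (simp add: C_def)
  ultimately have "C = ?B"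
    using left_inverse_unique[OF c(1) _ c(2) _ conc_inv_mult[OF n G]] by blast
  moreover have "C $$ (i, j) = ?B $$ (\<pi> i, \<pi> j)" using ij by (simp add: C_def)
  ultimately show ?thesis by simp
qed

section \<open>Linear binomials in the vanishing ideal\<close>

lemma single_1_eq_iff:
  "Poly_Mapping.single a (1 :: nat) = Poly_Mapping.single b 1 \<longleftrightarrow> a = b"
  by (auto dest!: arg_cong[where f = Poly_Mapping.keys])

lemma keys_mvar_diff:
  assumes "a \<noteq> b"
  shows "Poly_Mapping.keys (mvar a - mvar b) = {Poly_Mapping.single a 1, Poly_Mapping.single b 1}"
  using assms single_1_eq_iff[of a b]
  by (auto simp: mvar_def in_keys_iff lookup_minus lookup_single when_def split: if_splits)

lemma eval_mvar_diff:
  assumes "a \<noteq> b"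
  shows "eval_mpoly f (mvar a - mvar b) = f a - f b"
proof -
  have "mconst 1 = (1 :: 'b mpoly)" "mconst (- 1) = (- 1 :: 'b mpoly)"
    by (simp_all add: mconst_def single_uminus)
  moreover have "Poly_Mapping.lookup (mvar a - mvar b) (Poly_Mapping.single a 1) = 1"
    "Poly_Mapping.lookup (mvar a - mvar b) (Poly_Mapping.single b 1) = - 1"
    using assms single_1_eq_iff[of a b] single_1_eq_iff[of b a]
    by (simp_all add: mvar_def lookup_minus lookup_single when_def)
  ultimately show ?thesis
    using assms unfolding eval_mpoly_def keys_mvar_diff[OF assms]
    by (simp add: single_1_eq_iff[simplified])
qed

text \<open>Distinct pairs give distinct variables, so the binomial evaluates to a difference of two
  entries; \<open>sigma\<close> sorts its indices, which the symmetry of \<open>conc_inv\<close>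
  undoes.\<close>

lemma sigma_diff_in_ideal_iff:
  assumes n: "n \<in> {3, 5, 7}" and G: "colored_cycle n cv ce"
    and lt: "i < n" "j < n" "x < n" "y < n" and ne: "{i, j} \<noteq> {x, y}"
  shows "sigma i j - sigma x y \<in> vanishing_ideal n cv ce \<longleftrightarrow>
    conc_inv n cv ce $$ (i, j) = conc_inv n cv ce $$ (x, y)"
proof -
  have d: "(min i j, max i j) \<noteq> (min x y, max x y)" using ne by (auto simp: min_def max_def split: if_splits)
  have mm: "conc_inv n cv ce $$ (min a b, max a b) = conc_inv n cv ce $$ (a, b)" if "a < n" "b < n" for a b
    using conc_inv_sym[OF n G that] by (cases "a \<le> b") (simp_all add: min_def max_def)
  have "mvars (sigma i j - sigma x y) \<subseteq> {(i, j). i \<le> j \<and> j < n}"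
    using lt unfolding mvars_def sigma_def keys_mvar_diff[OF d] by auto
  then show ?thesis
    unfolding vanishing_ideal_def inv_conc_mat[OF n G]
    using lt by (simp add: sigma_def eval_mvar_diff[OF d] mm)
qed

section \<open>Centers of vertex pairs\<close>

lemma adj_poly_mod: "adj_poly n cv ce (k mod int n) l = adj_poly n cv ce k l"
proof (rule periodic_mod)
  fix s
  show "adj_poly n cv ce (s + int n) l = adj_poly n cv ce s l"
    using cyc_adj_shift[of n "\<lambda>k. mvar (vcol n cv k)" "int n" "\<lambda>k. mvar (ecol n ce k)" s l]
    by (simp add: adj_poly_def vcol_period ecol_period add.commute[of "int n"])
qed

text \<open>The two vertices are \<open>2 * h\<close> forward steps apart, a number that
  \<open>2 * h < n\<close> keeps from being reduced modulo \<open>n\<close>.\<close>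

lemma conc_inv_centered:
  assumes n: "2 * h < n"
  shows "conc_inv n cv ce $$ (nat ((c - int h) mod int n), nat ((c + int h) mod int n)) =
    to_fract (adj_poly n cv ce (c - int h) (2 * h)) / to_fract (det_poly n cv ce)"
proof -
  define i where "i = nat ((c - int h) mod int n)"
  define j where "j = nat ((c + int h) mod int n)"
  have i: "int i = (c - int h) mod int n" "i < n" and j: "int j = (c + int h) mod int n" "j < n"
    using n by (simp_all add: i_def j_def nat_less_iff)
  have "int ((j + (n - i)) mod n) = (int j - int i + int n) mod int n"
    using i(2) by (simp add: zmod_int of_nat_diff algebra_simps)
  also have "\<dots> = (int j - int i) mod int n" by simp
  also have "\<dots> = ((c + int h) - (c - int h)) mod int n" unfolding i j by (rule mod_diff_eq)
  also have "\<dots> = int (2 * h)" using n by simp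
  finally have "(j + (n - i)) mod n = 2 * h" by linarith
  then show ?thesis
    unfolding i_def[symmetric] j_def[symmetric] using i j by (simp add: conc_inv_def adj_poly_mod)
qed

text \<open>As \<open>n\<close> is odd, one of the two paths between the vertices has even length;
  its midpoint is the center.\<close>

lemma centered_pair:
  assumes n: "odd n" and ij: "i < n" "j < n"
  obtains c h where "2 * h < n" "{i, j} = {nat ((c - int h) mod int n), nat ((c + int h) mod int n)}"
proof -
  have *: "\<exists>c h. 2 * h < n \<and> {i, j} = {nat ((c - int h) mod int n), nat ((c + int h) mod int n)}"
    if ij: "i \<le> j" "j < n" for i j
  proof (cases "even (j - i)")
    case True
    then obtain h where h: "j - i = 2 * h" by blast
    then have "j = i + 2 * h" using ij by simp
    then show ?thesis using ij by (intro exI[of _ "int (i + h)"] exI[of _ h]) auto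
  next
    case False
    then have "even (n - (j - i))" using n ij by simp
    then obtain h where h: "n - (j - i) = 2 * h" by blast
    \<comment> \<open>The even path runs from \<open>j\<close> forward across 0 to \<open>i\<close>,
      so the center lies \<open>h\<close> steps after \<open>j\<close>.\<close>
    then have "int j + 2 * int h = int i + int n" using ij by linarith
    then have "(int j + int h + int h) mod int n = int i" using ij by (simp add: algebra_simps)
    moreover have "2 * h < n"
    proof -
      have "0 < j - i" using False by (intro gr0I) simp
      then show ?thesis using h ij by linarith
    qed
    ultimately show ?thesis using ij
      by (intro exI[of _ "int j + int h"] exI[of _ h]) (auto simp: insert_commute)
  qed
  show ?thesis
    using *[of i j] *[of j i] ij that by (metis insert_commute linorder_le_cases)
qed

text \<open>The forward distances between the two centers sum to the odd number \<open>n\<close>, so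
  one of them is even: \<open>m\<close> is its half and \<open>q\<close> the midpoint. The parity
  decides which center comes first, hence the disjunction.\<close>

lemma common_center:
  assumes n: "odd n" and cc: "c mod int n \<noteq> c' mod int n"
  obtains q m where "0 < m" "2 * m < int n"
    "c mod int n = (q + m) mod int n \<and> c' mod int n = (q - m) mod int n \<or>
     c mod int n = (q - m) mod int n \<and> c' mod int n = (q + m) mod int n"
proof -
  define d where "d = (c - c') mod int n"
  have n0: "0 < int n" using n by (auto intro: gr0I)
  have "d \<noteq> 0" using cc by (simp add: d_def mod_eq_dvd_iff dvd_eq_mod_eq_0)
  then have d: "0 < d" "d < int n" using n0 by (simp_all add: d_def order.not_eq_order_implies_strict)
  have cd: "(c' + d) mod int n = c mod int n" unfolding d_def by (simp add: mod_add_right_eq)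
  show ?thesis
  proof (cases "even d")
    case True
    then obtain m where m: "d = 2 * m" by blast
    show ?thesis by (rule that[of m "c' + m"]) (use d m cd in \<open>auto simp: algebra_simps\<close>)
  next
    case False
    then have "even (int n - d)" using n by simp
    then obtain m where m: "int n - d = 2 * m" by blast
    have "(c + 2 * m) mod int n = (c - d + int n) mod int n" using m by (simp add: algebra_simps)
    also have "\<dots> = (c - d) mod int n" by simp
    also have "\<dots> = c' mod int n" unfolding d_def by (simp add: mod_diff_right_eq)
    finally show ?thesis by (intro that[of m "c + m"]) (use d m in \<open>auto simp: algebra_simps\<close>)
  qed
qed

section \<open>Reflections\<close>

text \<open>Outside the cycle it is the identity, as \<open>permutes\<close> demands.\<close>

definition reflect :: "nat \<Rightarrow> int \<Rightarrow> nat \<Rightarrow> nat" where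
  "reflect n q a = (if a < n then nat ((2 * q - int a) mod int n) else a)"

lemma reflect_graph_symmetry:
  assumes n3: "3 \<le> n"
    and mirror: "\<And>t. vcol n cv (q - t) = vcol n cv (q + t)" "\<And>t. ecol n ce (q - 1 - t) = ecol n ce (q + t)"
  shows "graph_symmetry n cv ce (reflect n q)"
proof -
  let ?p = "\<lambda>k. nat (k mod int n)"
  define \<pi> where r: "\<pi> = reflect n q"
  have \<pi>_def: "\<pi> a = (if a < n then ?p (2 * q - int a) else a)" for a
    by (simp add: r reflect_def)
  have n0: "0 < int n" using n3 by simp
  have p_lt: "?p k < n" for k using n0 by (simp add: nat_less_iff)
  have \<pi>\<pi>: "\<pi> (\<pi> a) = a" for a
    using p_lt n0 by (simp add: \<pi>_def mod_diff_right_eq)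
  have "\<pi> permutes {..<n}"
    by (rule bij_imp_permutes) (auto intro!: bij_betwI[where g = \<pi>] simp: \<pi>\<pi>, auto simp: \<pi>_def p_lt)
  have cvV: "cv (\<pi> a) = cv a" if "a < n" for a
  proof -
    have "cv (\<pi> a) = vcol n cv (q - (int a - q))" using that by (simp add: \<pi>_def vcol_def algebra_simps)
    also have "\<dots> = cv a" using that unfolding mirror by (simp add: vcol_def)
    finally show ?thesis .
  qed
  have edge: "{\<pi> a, \<pi> b} \<in> cycle_edges n \<and> ce {\<pi> a, \<pi> b} = ce {a, b}" if "a < n" "b = Suc a mod n" for a b
  proof -
    have b: "b < n" "int b = (int a + 1) mod int n" using that n3 by (simp_all add: zmod_int add.commute)
    have pa: "\<pi> a = ?p (2 * q - int a)" using that by (simp add: \<pi>_def)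
    have "(2 * q - int b) mod int n = (2 * q - int a - 1) mod int n"
      unfolding b(2) by (simp add: mod_diff_right_eq algebra_simps)
    then have pb: "\<pi> b = ?p (2 * q - int a - 1)" using b(1) by (simp add: \<pi>_def)
    \<comment> \<open>The reflection reverses the orientation of the edge.\<close>
    have "\<pi> a = Suc (\<pi> b) mod n"
      using nat_mod_Suc[of n "2 * q - int a - 1"] n3 unfolding pa pb by simp
    moreover have "\<pi> a < n" "\<pi> b < n" by (simp_all add: pa pb p_lt)
    moreover have "ce {\<pi> a, \<pi> b} = ecol n ce (q - 1 - (int a - q))"
      unfolding ecol_def pa pb by (simp add: insert_commute algebra_simps)
    moreover have "ecol n ce (q + (int a - q)) = ce {a, b}"
      using that b by (simp add: ecol_def flip: b(2))
    ultimately show ?thesis unfolding mirror by (simp add: cycle_edges_iff)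
  qed
  have "graph_symmetry n cv ce \<pi>"
    unfolding graph_symmetry_iff
  proof (intro conjI allI impI)
    fix a b
    assume ab: "a < n" "b < n"
    have lt: "\<pi> a < n" "\<pi> b < n" using ab by (simp_all add: \<pi>_def p_lt)
    have inj: "\<pi> a = \<pi> b \<longleftrightarrow> a = b" by (metis \<pi>\<pi>)
    have fwd: "{\<pi> a, \<pi> b} \<in> cycle_edges n \<and> ce {\<pi> a, \<pi> b} = ce {a, b}"
      if "a < n" "b < n" "{a, b} \<in> cycle_edges n" for a b
      using that(3) edge[of a b] edge[of b a] that(1,2) unfolding cycle_edges_iff[OF that(1,2)]
      by (auto simp: insert_commute)
    \<comment> \<open>As \<pi> is an involution, preservation of edges applied to the images also
      gives the converse.\<close>
    have "{a, b} \<in> cycle_edges n" if "{\<pi> a, \<pi> b} \<in> cycle_edges n"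
      using fwd[OF lt that] by (simp add: \<pi>\<pi>)
    then show "conc_mat n cv ce $$ (\<pi> a, \<pi> b) = conc_mat n cv ce $$ (a, b)"
      using fwd[OF ab] ab lt by (auto simp: conc_mat_def inj cvV)
  qed fact
  then show ?thesis by (simp add: r)
qed

section \<open>Equivalence of linear binomials and reflections of the cycle\<close>

theorem mainTheorem6:
  fixes n :: nat
    and cv :: "nat \<Rightarrow> 'c::linorder"
    and ce :: "nat set \<Rightarrow> 'c"
    and i j x y :: nat
  assumes "n \<in> {3, 5, 7}"
    and "colored_cycle n cv ce"
    and "i < n" and "j < n" and "x < n" and "y < n"
    and "{i, j} \<noteq> {x, y}"
  shows "sigma i j - sigma x y \<in> vanishing_ideal n cv ce \<longleftrightarrow>
    (\<exists>\<pi>. graph_symmetry n cv ce \<pi> \<and> {\<pi> i, \<pi> j} = {x, y})"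
proof
  note n = assms(1) and G = assms(2)
  let ?B = "conc_inv n cv ce"
  have sym: "?B $$ (b, a) = ?B $$ (a, b)" if "a < n" "b < n" for a b
    using conc_inv_sym[OF n G that] .
  {
    assume "\<exists>\<pi>. graph_symmetry n cv ce \<pi> \<and> {\<pi> i, \<pi> j} = {x, y}"
    then obtain \<pi> where \<pi>: "graph_symmetry n cv ce \<pi>" "{\<pi> i, \<pi> j} = {x, y}" by blast
    have "?B $$ (\<pi> i, \<pi> j) = ?B $$ (i, j)"
      by (rule conc_inv_symmetry[OF n G \<pi>(1) assms(3,4)])
    moreover have "?B $$ (\<pi> i, \<pi> j) = ?B $$ (x, y)"
      using \<pi>(2) sym[OF assms(5,6)] by (auto simp: doubleton_eq_iff)
    ultimately show "sigma i j - sigma x y \<in> vanishing_ideal n cv ce"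
      using sigma_diff_in_ideal_iff[OF n G assms(3-7)] by simp
  }
  assume "sigma i j - sigma x y \<in> vanishing_ideal n cv ce"
  then have B: "?B $$ (i, j) = ?B $$ (x, y)"
    using sigma_diff_in_ideal_iff[OF n G assms(3-7)] by simp
  have odd: "odd n" and n0: "0 < int n" and n3: "3 \<le> n" using n by auto
  let ?p = "\<lambda>k. nat (k mod int n)"
  have p_lt: "?p k < n" for k using n0 by (simp add: nat_less_iff)
  obtain c h where h: "2 * h < n" "{i, j} = {?p (c - int h), ?p (c + int h)}"
    using centered_pair[OF odd assms(3,4)] by blast
  obtain c' h' where h': "2 * h' < n" "{x, y} = {?p (c' - int h'), ?p (c' + int h')}"
    using centered_pair[OF odd assms(5,6)] by blast
  have "?B $$ (?p (c - int h), ?p (c + int h)) = ?B $$ (i, j)"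
    using h(2) sym[OF assms(3,4)] by (auto simp: doubleton_eq_iff)
  moreover have "?B $$ (?p (c' - int h'), ?p (c' + int h')) = ?B $$ (x, y)"
    using h'(2) sym[OF assms(5,6)] by (auto simp: doubleton_eq_iff)
  ultimately have "?B $$ (?p (c - int h), ?p (c + int h)) = ?B $$ (?p (c' - int h'), ?p (c' + int h'))"
    using B by simp
  \<comment> \<open>The common nonzero denominator cancels, which leaves an identity of polynomials
    that can be specialized to real values.\<close>
  then have adj: "adj_poly n cv ce (c - int h) (2 * h) = adj_poly n cv ce (c' - int h') (2 * h')"
    unfolding conc_inv_centered[OF h(1)] conc_inv_centered[OF h'(1)] using det_poly_nonzero[OF G] by simp
  let ?V = "vcol n cv" and ?E = "ecol n ce"
  note VE = vcol_neq_ecol[OF G]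
  have eval: "cyc_adj n (\<lambda>k. \<alpha> (?V k)) (\<lambda>k. \<alpha> (?E k)) (c - int h) (2 * h) =
      cyc_adj n (\<lambda>k. \<alpha> (?V k)) (\<lambda>k. \<alpha> (?E k)) (c' - int h') (2 * h')" for \<alpha> :: "'c \<Rightarrow> real"
    using arg_cong[OF adj, of "real_eval \<alpha>"] by (simp add: real_eval_adj_poly)
  have "h = h'"
  proof (rule cyc_adj_separates_distance[OF n h(1) h'(1)])
    have "?E k \<notin> range ?V" for k using VE by (metis rangeE)
    then show "cyc_adj n (\<lambda>_. 1) (\<lambda>_. 1 / 10 :: real) (c - int h) (2 * h) =
        cyc_adj n (\<lambda>_. 1) (\<lambda>_. 1 / 10) (c' - int h') (2 * h')"
      using eval[of "\<lambda>a. if a \<in> range ?V then 1 else 1 / 10"] by simp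
  qed
  have adj_mod: "cyc_adj n (\<lambda>k. \<alpha> (?V k)) (\<lambda>k. \<alpha> (?E k)) (a - int h) l =
      cyc_adj n (\<lambda>k. \<alpha> (?V k)) (\<lambda>k. \<alpha> (?E k)) (b - int h) l"
    if "a mod int n = b mod int n" for \<alpha> :: "'c \<Rightarrow> real" and a b l
  proof -
    have "(a - int h) mod int n = (b - int h) mod int n" using that by (rule mod_diff_cong) simp
    then have "adj_poly n cv ce (a - int h) l = adj_poly n cv ce (b - int h) l" by (metis adj_poly_mod)
    then show ?thesis by (metis real_eval_adj_poly)
  qed
  \<comment> \<open>With equal half-lengths, equal centers would make the two pairs
    coincide.\<close>
  have "c mod int n \<noteq> c' mod int n"
  proof
    assume "c mod int n = c' mod int n"
    then have "(c - int h) mod int n = (c' - int h) mod int n" "(c + int h) mod int n = (c' + int h) mod int n"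
      by (metis mod_diff_left_eq, metis mod_add_left_eq)
    then show False using assms(7) h(2) h'(2) \<open>h = h'\<close> by simp
  qed
  then obtain q m where m: "0 < m" "2 * m < int n" and
    q: "c mod int n = (q + m) mod int n \<and> c' mod int n = (q - m) mod int n \<or>
      c mod int n = (q - m) mod int n \<and> c' mod int n = (q + m) mod int n"
    by (rule common_center[OF odd])
  \<comment> \<open>The two alternatives for the order of the centers only exchange the sides of
    this equation.\<close>
  have "cyc_adj n (\<lambda>k. \<alpha> (?V k)) (\<lambda>k. \<alpha> (?E k)) (q + m - int h) (2 * h) =
      cyc_adj n (\<lambda>k. \<alpha> (?V k)) (\<lambda>k. \<alpha> (?E k)) (q - m - int h) (2 * h)" for \<alpha> :: "'c \<Rightarrow> real"
    using q eval[of \<alpha>] adj_mod[of c _ \<alpha>] adj_mod[of c' _ \<alpha>] unfolding \<open>h = h'\<close>[symmetric] by metis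
  from colored_mirror[OF n h(1) m vcol_period ecol_period VE this]
  have mirror: "?V (q - t) = ?V (q + t)" "?E (q - 1 - t) = ?E (q + t)" for t by blast+
  have "graph_symmetry n cv ce (reflect n q)"
    by (rule reflect_graph_symmetry[OF n3]) (use mirror in auto)
  moreover have "{reflect n q i, reflect n q j} = {x, y}"
  proof -
    \<comment> \<open>Since the centers sum to \<open>2 * q\<close>, the reflection at
      \<open>q\<close> exchanges them and maps \<open>c + k\<close> to
      \<open>c' - k\<close>.\<close>
    have "(c + c') mod int n = (2 * q) mod int n"
    proof -
      have "(c + c') mod int n = ((q + m) + (q - m)) mod int n"
        using q by (metis mod_add_cong add.commute)
      then show ?thesis by simp
    qed
    then have "(2 * q - (c + k)) mod int n = (c' - k) mod int n" for k
      using mod_diff_cong[of "c + c'" "int n" "2 * q" "c + k" "c + k"] by simp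
    then have img: "reflect n q (?p (c + k)) = ?p (c' - k)" for k
      using p_lt n0 by (simp add: reflect_def mod_diff_right_eq)
    have "{reflect n q i, reflect n q j} = reflect n q ` {?p (c - int h), ?p (c + int h)}" unfolding h(2)[symmetric] by simp
    also have "\<dots> = {x, y}"
      using img[of "- int h"] img[of "int h"] h'(2) \<open>h = h'\<close> by auto
    finally show ?thesis .
  qed
  ultimately show "\<exists>\<pi>. graph_symmetry n cv ce \<pi> \<and> {\<pi> i, \<pi> j} = {x, y}" by blast
qed

end
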